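(* Let $R$ be a ring of the standard form below with generating character $\chi$. Define the partition $\mathcal H'=(P_m)_{m\in\mathcal M\cup\{\diamond\}}$ of $R$ by $P_\diamond=R\setminus\mathrm{soc}(R)$ and, for $m=(m_1,\dots,m_t)\in\mathcal M:=\{0,\dots,n_1\}\times\cdots\times\{0,\dots,n_t\}$, $P_m=\{(a_1,\dots,a_t)\in\mathrm{soc}(R):\mathrm{wt}(a_i)=m_i\ \forall i\}$ (discarding $P_\diamond$ if it is empty). Then the right $\chi$-dual partition of $\mathcal H'$ does not depend on $\chi$, coincides with the left $\chi$-dual partition, and equals $(Q_m)_{m\in\mathcal M\cup\{\diamond\}}$, where $Q_\diamond=\mathrm{rad}(R)\setminus\{0\}$, $Q_0=\{0\}$, and for $m\in\mathcal M\setminus\{0\}$, $$Q_m=\{(a_1,\dots,a_t)\in R\setminus\mathrm{rad}(R):\ \mathrm{wt}(a_i+\mathrm{rad}(R_i))=m_i\ \text{for all } i\}$$ (again discarding empty sets). In particular $\mathcal H'$ is reflexive. If $R=\mathrm{soc}(R)$, then $\mathcal H'$ has $s:=\prod_{i=1}^t(n_i+1)$ blocks, equals the product of the Hamming partitions on the $R_i$, and is self-dual; if $R\ne\mathrm{soc}(R)$, then $\mathcal H'$ has $s+1$ blocks.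
   Context: Standard form: $R=R_1\times\cdots\times R_t$ with $R_i=R_{i,1}\times\cdots\times R_{i,n_i}$, where each $R_{i,j}$ is a finite local Frobenius ring with $|R_{i,j}/\mathrm{rad}(R_{i,j})|=|\mathrm{soc}(R_{i,j})|=q_i$ for all $j$, and $q_1,\dots,q_t$ distinct ($\mathrm{rad}$ = Jacobson radical, $\mathrm{soc}$ = socle; $\mathrm{rad}(R)$ and $\mathrm{soc}(R)$ are the products of the components' radicals resp. socles). A finite ring is Frobenius if it admits a generating character, i.e. a character $\chi$ of its additive group such that $r\mapsto(x\mapsto\chi(xr))$ is a bijection onto the character group. For $a_i=(a_{i,1},\dots,a_{i,n_i})\in R_i$: $\mathrm{wt}(a_i)=|\{j:a_{i,j}\neq0\}|$ and $\mathrm{wt}(a_i+\mathrm{rad}(R_i))=|\{j:a_{i,j}\notin\mathrm{rad}(R_{i,j})\}|$. For a partition $\mathcal P$ of $R$, the right $\chi$-dual partition is given by $a\sim a'$ iff $\sum_{b\in P}\chi(ab)=\sum_{b\in P}\chi(a'b)$ for all blocks $P$ of $\mathcal P$; the left $\chi$-dual uses $\chi(ba)$. $\mathcal P$ is reflexive if the left $\chi$-dual of its right $\chi$-dual equals $\mathcal P$ (equivalently, $\mathcal P$ and its right $\chi$-dual have the same number of blocks), and self-dual if $\mathcal P$ equals its right $\chi$-dual. *)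

theory Defs
  imports "HOL-Algebra.QuotRing" "HOL-Library.FuncSet" Complex_Main
begin

definition left_ideal :: "('a, 'b) ring_scheme \<Rightarrow> 'a set \<Rightarrow> bool" where
  "left_ideal A I \<longleftrightarrow> additive_subgroup I A \<and>
     (\<forall>r\<in>carrier A. \<forall>x\<in>I. r \<otimes>\<^bsub>A\<^esub> x \<in> I)"

definition maximal_left_ideal :: "('a, 'b) ring_scheme \<Rightarrow> 'a set \<Rightarrow> bool" where
  "maximal_left_ideal A I \<longleftrightarrow> left_ideal A I \<and> I \<noteq> carrier A \<and>
     (\<forall>J. left_ideal A J \<and> I \<subseteq> J \<longrightarrow> J = I \<or> J = carrier A)"

definition minimal_left_ideal :: "('a, 'b) ring_scheme \<Rightarrow> 'a set \<Rightarrow> bool" where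
  "minimal_left_ideal A I \<longleftrightarrow> left_ideal A I \<and> I \<noteq> {\<zero>\<^bsub>A\<^esub>} \<and>
     (\<forall>J. left_ideal A J \<and> J \<subseteq> I \<longrightarrow> J = {\<zero>\<^bsub>A\<^esub>} \<or> J = I)"

definition jacobson_rad :: "('a, 'b) ring_scheme \<Rightarrow> 'a set" where
  "jacobson_rad A = carrier A \<inter> \<Inter>{I. maximal_left_ideal A I}"

text \<open>(Left) socle: the sum of all minimal left ideals, i.e. the smallest left ideal
  containing every minimal left ideal.\<close>
definition socle :: "('a, 'b) ring_scheme \<Rightarrow> 'a set" where
  "socle A = \<Inter>{J. left_ideal A J \<and> (\<forall>I. minimal_left_ideal A I \<longrightarrow> I \<subseteq> J)}"

definition local_ring :: "('a, 'b) ring_scheme \<Rightarrow> bool" where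
  "local_ring A \<longleftrightarrow> ring A \<and> (\<exists>!I. maximal_left_ideal A I)"

definition additive_character :: "('a, 'b) ring_scheme \<Rightarrow> ('a \<Rightarrow> complex) \<Rightarrow> bool" where
  "additive_character A \<psi> \<longleftrightarrow> \<psi> \<in> extensional (carrier A) \<and> \<psi> \<zero>\<^bsub>A\<^esub> = 1 \<and>
     (\<forall>x\<in>carrier A. \<forall>y\<in>carrier A. \<psi> (x \<oplus>\<^bsub>A\<^esub> y) = \<psi> x * \<psi> y)"

definition generating_character :: "('a, 'b) ring_scheme \<Rightarrow> ('a \<Rightarrow> complex) \<Rightarrow> bool" where
  "generating_character A \<chi> \<longleftrightarrow> additive_character A \<chi> \<and>
     bij_betw (\<lambda>r. \<lambda>x\<in>carrier A. \<chi> (x \<otimes>\<^bsub>A\<^esub> r)) (carrier A) {\<psi>. additive_character A \<psi>}"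

definition frobenius_ring :: "('a, 'b) ring_scheme \<Rightarrow> bool" where
  "frobenius_ring A \<longleftrightarrow> (\<exists>\<chi>. generating_character A \<chi>)"

definition finite_local_frobenius :: "('a, 'b) ring_scheme \<Rightarrow> bool" where
  "finite_local_frobenius A \<longleftrightarrow> ring A \<and> finite (carrier A) \<and> local_ring A \<and> frobenius_ring A"

text \<open>A partition is represented as its set of blocks.\<close>

definition right_dual_rel ::
  "('a, 'b) ring_scheme \<Rightarrow> ('a \<Rightarrow> complex) \<Rightarrow> 'a set set \<Rightarrow> ('a \<times> 'a) set" where
  "right_dual_rel A \<chi> \<P> = {(a, a'). a \<in> carrier A \<and> a' \<in> carrier A \<and>
     (\<forall>P\<in>\<P>. (\<Sum>b\<in>P. \<chi> (a \<otimes>\<^bsub>A\<^esub> b)) = (\<Sum>b\<in>P. \<chi> (a' \<otimes>\<^bsub>A\<^esub> b)))}"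

definition left_dual_rel ::
  "('a, 'b) ring_scheme \<Rightarrow> ('a \<Rightarrow> complex) \<Rightarrow> 'a set set \<Rightarrow> ('a \<times> 'a) set" where
  "left_dual_rel A \<chi> \<P> = {(a, a'). a \<in> carrier A \<and> a' \<in> carrier A \<and>
     (\<forall>P\<in>\<P>. (\<Sum>b\<in>P. \<chi> (b \<otimes>\<^bsub>A\<^esub> a)) = (\<Sum>b\<in>P. \<chi> (b \<otimes>\<^bsub>A\<^esub> a')))}"

definition right_dual :: "('a, 'b) ring_scheme \<Rightarrow> ('a \<Rightarrow> complex) \<Rightarrow> 'a set set \<Rightarrow> 'a set set" where
  "right_dual A \<chi> \<P> = carrier A // right_dual_rel A \<chi> \<P>"

definition left_dual :: "('a, 'b) ring_scheme \<Rightarrow> ('a \<Rightarrow> complex) \<Rightarrow> 'a set set \<Rightarrow> 'a set set" where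
  "left_dual A \<chi> \<P> = carrier A // left_dual_rel A \<chi> \<P>"

definition reflexive_partition :: "('a, 'b) ring_scheme \<Rightarrow> ('a \<Rightarrow> complex) \<Rightarrow> 'a set set \<Rightarrow> bool" where
  "reflexive_partition A \<chi> \<P> \<longleftrightarrow> left_dual A \<chi> (right_dual A \<chi> \<P>) = \<P>"

definition self_dual_partition :: "('a, 'b) ring_scheme \<Rightarrow> ('a \<Rightarrow> complex) \<Rightarrow> 'a set set \<Rightarrow> bool" where
  "self_dual_partition A \<chi> \<P> \<longleftrightarrow> right_dual A \<chi> \<P> = \<P>"

text \<open>Elements of R are functions a with a i \<in> R_i (for i < t) and a i j \<in> R_{i,j}
  (for j < n i), extensional outside these index ranges.\<close>

definition comp_carrier :: "nat \<Rightarrow> (nat \<Rightarrow> nat \<Rightarrow> 'a ring) \<Rightarrow> nat \<Rightarrow> (nat \<Rightarrow> 'a) set" where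
  "comp_carrier n Rc i = (\<Pi>\<^sub>E j\<in>{..<n}. carrier (Rc i j))"

definition std_ring :: "nat \<Rightarrow> (nat \<Rightarrow> nat) \<Rightarrow> (nat \<Rightarrow> nat \<Rightarrow> 'a ring) \<Rightarrow> (nat \<Rightarrow> nat \<Rightarrow> 'a) ring" where
  "std_ring t n Rc =
    \<lparr>carrier = (\<Pi>\<^sub>E i\<in>{..<t}. comp_carrier (n i) Rc i),
     mult = (\<lambda>a b. \<lambda>i\<in>{..<t}. \<lambda>j\<in>{..<n i}. a i j \<otimes>\<^bsub>Rc i j\<^esub> b i j),
     one = (\<lambda>i\<in>{..<t}. \<lambda>j\<in>{..<n i}. \<one>\<^bsub>Rc i j\<^esub>),
     zero = (\<lambda>i\<in>{..<t}. \<lambda>j\<in>{..<n i}. \<zero>\<^bsub>Rc i j\<^esub>),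
     add = (\<lambda>a b. \<lambda>i\<in>{..<t}. \<lambda>j\<in>{..<n i}. a i j \<oplus>\<^bsub>Rc i j\<^esub> b i j)\<rparr>"

definition std_rad :: "nat \<Rightarrow> (nat \<Rightarrow> nat) \<Rightarrow> (nat \<Rightarrow> nat \<Rightarrow> 'a ring) \<Rightarrow> (nat \<Rightarrow> nat \<Rightarrow> 'a) set" where
  "std_rad t n Rc = (\<Pi>\<^sub>E i\<in>{..<t}. \<Pi>\<^sub>E j\<in>{..<n i}. jacobson_rad (Rc i j))"

definition std_soc :: "nat \<Rightarrow> (nat \<Rightarrow> nat) \<Rightarrow> (nat \<Rightarrow> nat \<Rightarrow> 'a ring) \<Rightarrow> (nat \<Rightarrow> nat \<Rightarrow> 'a) set" where
  "std_soc t n Rc = (\<Pi>\<^sub>E i\<in>{..<t}. \<Pi>\<^sub>E j\<in>{..<n i}. socle (Rc i j))"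

definition hwt :: "nat \<Rightarrow> (nat \<Rightarrow> 'a ring) \<Rightarrow> (nat \<Rightarrow> 'a) \<Rightarrow> nat" where
  "hwt m Ri x = card {j. j < m \<and> x j \<noteq> \<zero>\<^bsub>Ri j\<^esub>}"

definition hwt_rad :: "nat \<Rightarrow> (nat \<Rightarrow> 'a ring) \<Rightarrow> (nat \<Rightarrow> 'a) \<Rightarrow> nat" where
  "hwt_rad m Ri x = card {j. j < m \<and> x j \<notin> jacobson_rad (Ri j)}"

definition idx_set :: "nat \<Rightarrow> (nat \<Rightarrow> nat) \<Rightarrow> (nat \<Rightarrow> nat) set" where
  "idx_set t n = (\<Pi>\<^sub>E i\<in>{..<t}. {0..n i})"

definition idx_zero :: "nat \<Rightarrow> nat \<Rightarrow> nat" where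
  "idx_zero t = (\<lambda>i\<in>{..<t}. 0)"

definition H_block :: "nat \<Rightarrow> (nat \<Rightarrow> nat) \<Rightarrow> (nat \<Rightarrow> nat \<Rightarrow> 'a ring) \<Rightarrow> (nat \<Rightarrow> nat) \<Rightarrow> (nat \<Rightarrow> nat \<Rightarrow> 'a) set" where
  "H_block t n Rc m = {a \<in> std_soc t n Rc. \<forall>i<t. hwt (n i) (Rc i) (a i) = m i}"

definition H_diamond :: "nat \<Rightarrow> (nat \<Rightarrow> nat) \<Rightarrow> (nat \<Rightarrow> nat \<Rightarrow> 'a ring) \<Rightarrow> (nat \<Rightarrow> nat \<Rightarrow> 'a) set" where
  "H_diamond t n Rc = carrier (std_ring t n Rc) - std_soc t n Rc"

definition H_partition :: "nat \<Rightarrow> (nat \<Rightarrow> nat) \<Rightarrow> (nat \<Rightarrow> nat \<Rightarrow> 'a ring) \<Rightarrow> (nat \<Rightarrow> nat \<Rightarrow> 'a) set set" where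
  "H_partition t n Rc =
     {B \<in> insert (H_diamond t n Rc) (H_block t n Rc ` idx_set t n). B \<noteq> {}}"

definition Q_block :: "nat \<Rightarrow> (nat \<Rightarrow> nat) \<Rightarrow> (nat \<Rightarrow> nat \<Rightarrow> 'a ring) \<Rightarrow> (nat \<Rightarrow> nat) \<Rightarrow> (nat \<Rightarrow> nat \<Rightarrow> 'a) set" where
  "Q_block t n Rc m =
     (if m = idx_zero t then {\<zero>\<^bsub>std_ring t n Rc\<^esub>}
      else {a \<in> carrier (std_ring t n Rc) - std_rad t n Rc.
              \<forall>i<t. hwt_rad (n i) (Rc i) (a i) = m i})"

definition Q_diamond :: "nat \<Rightarrow> (nat \<Rightarrow> nat) \<Rightarrow> (nat \<Rightarrow> nat \<Rightarrow> 'a ring) \<Rightarrow> (nat \<Rightarrow> nat \<Rightarrow> 'a) set" where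
  "Q_diamond t n Rc = std_rad t n Rc - {\<zero>\<^bsub>std_ring t n Rc\<^esub>}"

definition Q_partition :: "nat \<Rightarrow> (nat \<Rightarrow> nat) \<Rightarrow> (nat \<Rightarrow> nat \<Rightarrow> 'a ring) \<Rightarrow> (nat \<Rightarrow> nat \<Rightarrow> 'a) set set" where
  "Q_partition t n Rc =
     {B \<in> insert (Q_diamond t n Rc) (Q_block t n Rc ` idx_set t n). B \<noteq> {}}"

definition hamming_partition :: "nat \<Rightarrow> (nat \<Rightarrow> 'a ring) \<Rightarrow> (nat \<Rightarrow> 'a) set set" where
  "hamming_partition m Ri =
     {B \<in> (\<lambda>k. {x \<in> (\<Pi>\<^sub>E j\<in>{..<m}. carrier (Ri j)). hwt m Ri x = k}) ` {0..m}. B \<noteq> {}}"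

definition product_partition :: "nat \<Rightarrow> (nat \<Rightarrow> 'c set set) \<Rightarrow> (nat \<Rightarrow> 'c) set set" where
  "product_partition t \<P> = (\<lambda>B. \<Pi>\<^sub>E i\<in>{..<t}. B i) ` (\<Pi>\<^sub>E i\<in>{..<t}. \<P> i)"

end

theory Submission
  imports Defs "HOL-Computational_Algebra.Polynomial"
begin

text \<open>
  In each component the left socle is a simple left module annihilated on both sides by the radical,
  and every element outside the radical is a unit. A generating character is a product of component
  characters, and it is nontrivial on every nonzero one-sided ideal. Hence the character sum of
  \<open>a\<close> over the nonzero elements of a component socle is \<open>q - 1\<close> or \<open>-1\<close> according to whether \<open>a\<close> lies in
  the radical, on either side of multiplication. The sums over the blocks \<open>P\<^sub>m\<close> are therefore products
  of Krawtchouk coefficients at the weights modulo the radical, i.e. coefficients of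
  \<open>(1 + (q - 1) X)\<^bsup>n - w\<^esup> (1 - X)\<^bsup>w\<^esup>\<close>, and these determine \<open>w\<close>. The block \<open>P\<^sub>\<diamond>\<close> only adds the
  information whether \<open>a = 0\<close>. For reflexivity the same computation is done with the radical and its
  complement in place of \<open>{0}\<close> and the nonzero part of the socle.
\<close>

section \<open>Finite local rings\<close>

text \<open>The rings need not be commutative, and every notion is one-sided: radical and socle are
  built from left ideals, and injectivity of \<open>r \<mapsto> (x \<mapsto> \<chi> (x r))\<close>
  makes \<open>\<chi>\<close> nontrivial on nonzero left ideals only. Finiteness supplies the other
  side: left inverses are two-sided, so the radical is a two-sided ideal; a descent on principal
  left ideals shows that the radical kills the socle from the right as well; counting carries
  nondegeneracy across.

  In the generating polynomial of the block sums at \<open>a\<close>, the exponent of X counts the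
  nonzero coordinates of the summation variable. A coordinate of \<open>a\<close> in the radical
  contributes the factor 1 + (q - 1) X, any other coordinate 1 - X. At X = 1 these take the values q
  and 0, which is why the number of factors of each kind can be recovered.

  Both partitions are written as quotients by explicit equivalence relations, so that dual
  partitions are compared as relations and the convention of discarding empty blocks is dealt with
  once.\<close>

lemma left_idealD:
  assumes "left_ideal A I"
  shows "additive_subgroup I A" and "\<And>r x. r \<in> carrier A \<Longrightarrow> x \<in> I \<Longrightarrow> r \<otimes>\<^bsub>A\<^esub> x \<in> I"
  using assms by (auto simp: left_ideal_def)

lemma left_ideal_subset: "left_ideal A I \<Longrightarrow> I \<subseteq> carrier A"
  by (simp add: left_ideal_def additive_subgroup.a_subset)

text \<open>Closure under negation comes from left multiplication by
  \<open>\<ominus> \<one>\<close>.\<close>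

lemma (in ring) left_idealI:
  assumes "I \<subseteq> carrier R" "\<zero> \<in> I" "\<And>x y. x \<in> I \<Longrightarrow> y \<in> I \<Longrightarrow> x \<oplus> y \<in> I"
    and "\<And>r x. r \<in> carrier R \<Longrightarrow> x \<in> I \<Longrightarrow> r \<otimes> x \<in> I"
  shows "left_ideal R I"
proof -
  have "\<ominus> x \<in> I" if "x \<in> I" for x
  proof -
    have "(\<ominus> \<one>) \<otimes> x \<in> I" using assms that by auto
    moreover have "(\<ominus> \<one>) \<otimes> x = \<ominus> x" using assms(1) that by (auto simp: l_minus)
    ultimately show ?thesis by simp
  qed
  then have "subgroup I (add_monoid R)"
    using assms by (intro add.subgroupI) (auto simp: a_inv_def)
  then show ?thesis using assms by (auto simp: left_ideal_def additive_subgroup_def)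
qed

lemma (in ring) left_ideal_principal:
  assumes "x \<in> carrier R"
  shows "left_ideal R ((\<lambda>r. r \<otimes> x) ` carrier R)"
proof (rule left_idealI)
  show "\<zero> \<in> (\<lambda>r. r \<otimes> x) ` carrier R"
    using assms by (intro image_eqI[of _ _ \<zero>]) auto
  fix y z assume "y \<in> (\<lambda>r. r \<otimes> x) ` carrier R" "z \<in> (\<lambda>r. r \<otimes> x) ` carrier R"
  then obtain r s where "r \<in> carrier R" "s \<in> carrier R" "y = r \<otimes> x" "z = s \<otimes> x" by auto
  then show "y \<oplus> z \<in> (\<lambda>r. r \<otimes> x) ` carrier R"
    using assms by (intro image_eqI[of _ _ "r \<oplus> s"]) (auto simp: l_distr)
next
  fix r y assume "r \<in> carrier R" "y \<in> (\<lambda>r. r \<otimes> x) ` carrier R"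
  then obtain s where "s \<in> carrier R" "y = s \<otimes> x" by auto
  then show "r \<otimes> y \<in> (\<lambda>r. r \<otimes> x) ` carrier R"
    using assms \<open>r \<in> carrier R\<close> by (intro image_eqI[of _ _ "r \<otimes> s"]) (auto simp: m_assoc)
qed (use assms in auto)

text \<open>A left inverse makes left multiplication by \<open>x\<close> injective, hence surjective
  on a finite ring. So \<open>x\<close> has a right inverse, which must coincide with
  \<open>y\<close>.\<close>

lemma (in ring) finite_left_inverse_imp_right_inverse:
  assumes fin: "finite (carrier R)" and "x \<in> carrier R" "y \<in> carrier R" "y \<otimes> x = \<one>"
  shows "x \<otimes> y = \<one>"
proof -
  have "inj_on ((\<otimes>) x) (carrier R)"
  proof (rule inj_onI)
    fix z w assume zw: "z \<in> carrier R" "w \<in> carrier R" "x \<otimes> z = x \<otimes> w"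
    then have "(y \<otimes> x) \<otimes> z = (y \<otimes> x) \<otimes> w" using assms(2,3) by (simp add: m_assoc)
    then show "z = w" using assms zw by simp
  qed
  then have "(\<otimes>) x ` carrier R = carrier R"
    using fin assms by (intro endo_inj_surj) auto
  then obtain z where z: "z \<in> carrier R" "x \<otimes> z = \<one>" by (metis one_closed imageE)
  have "(y \<otimes> x) \<otimes> z = y \<otimes> (x \<otimes> z)" using assms(2,3) z(1) by (simp add: m_assoc)
  then show ?thesis using assms z by simp
qed

text \<open>Finiteness takes the place of Zorn's lemma, here and for minimal left ideals
  below.\<close>

lemma left_ideal_in_maximal:
  assumes "finite (carrier A)" "left_ideal A I" "I \<noteq> carrier A"
  shows "\<exists>M. maximal_left_ideal A M \<and> I \<subseteq> M"
proof -
  define S where "S = {J. left_ideal A J \<and> I \<subseteq> J \<and> J \<noteq> carrier A}"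
  have "S \<subseteq> Pow (carrier A)"
    by (auto simp: S_def dest: left_ideal_subset)
  then have "finite S" using assms(1) finite_subset by blast
  moreover have "I \<in> S" using assms by (simp add: S_def)
  ultimately obtain M where M: "M \<in> S" "\<forall>J\<in>S. M \<subseteq> J \<longrightarrow> M = J"
    using finite_has_maximal2[of S I] by blast
  have "K = M \<or> K = carrier A" if "left_ideal A K" "M \<subseteq> K" for K
    using M(1) M(2)[rule_format, of K] that by (auto simp: S_def)
  then have "maximal_left_ideal A M"
    using M(1) by (simp add: S_def maximal_left_ideal_def)
  then show ?thesis using M(1) by (auto simp: S_def)
qed

lemma minimal_left_ideal_in:
  assumes "finite (carrier A)" "left_ideal A I" "I \<noteq> {\<zero>\<^bsub>A\<^esub>}"
  shows "\<exists>M. minimal_left_ideal A M \<and> M \<subseteq> I"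
proof -
  define S where "S = {J. left_ideal A J \<and> J \<subseteq> I \<and> J \<noteq> {\<zero>\<^bsub>A\<^esub>}}"
  have "S \<subseteq> Pow (carrier A)"
    by (auto simp: S_def dest: left_ideal_subset)
  then have "finite S" using assms(1) finite_subset by blast
  moreover have "I \<in> S" using assms by (simp add: S_def)
  ultimately obtain M where M: "M \<in> S" "\<forall>J\<in>S. J \<subseteq> M \<longrightarrow> M = J"
    using finite_has_minimal2[of S I] by blast
  have "K = {\<zero>\<^bsub>A\<^esub>} \<or> K = M" if "left_ideal A K" "K \<subseteq> M" for K
    using M(1) M(2)[rule_format, of K] that by (auto simp: S_def)
  then have "minimal_left_ideal A M"
    using M(1) by (simp add: S_def minimal_left_ideal_def)
  then show ?thesis using M(1) by (auto simp: S_def)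
qed

locale finite_local_ring = ring A for A (structure) +
  assumes finite_carrier: "finite (carrier A)"
    and unique_maximal: "\<exists>!I. maximal_left_ideal A I"
begin

abbreviation J where "J \<equiv> jacobson_rad A"
abbreviation L where "L \<equiv> socle A"

text \<open>The intersection that defines the radical runs over a single left ideal.\<close>

lemma J_maximal: "maximal_left_ideal A J" and maximal_eq_J: "maximal_left_ideal A I \<Longrightarrow> I = J"
proof -
  obtain M where M: "maximal_left_ideal A M" "\<And>I. maximal_left_ideal A I \<Longrightarrow> I = M"
    using unique_maximal by (elim ex1E) blast
  then have eq: "{I. maximal_left_ideal A I} = {M}" by blast
  have "M \<subseteq> carrier A"
    using M(1) left_ideal_subset unfolding maximal_left_ideal_def by blast
  then have "J = M" unfolding jacobson_rad_def eq by auto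
  then show "maximal_left_ideal A J" and "maximal_left_ideal A I \<Longrightarrow> I = J" using M by blast+
qed

lemma J_left_ideal: "left_ideal A J"
  using J_maximal by (simp add: maximal_left_ideal_def)

lemma J_subgroup: "additive_subgroup J A"
  by (rule left_idealD(1)[OF J_left_ideal])

lemma J_carrier: "x \<in> J \<Longrightarrow> x \<in> carrier A"
  by (simp add: jacobson_rad_def)

lemma J_lmult: "r \<in> carrier A \<Longrightarrow> x \<in> J \<Longrightarrow> r \<otimes> x \<in> J"
  by (rule left_idealD(2)[OF J_left_ideal])

lemma zero_J: "\<zero> \<in> J"
  by (rule additive_subgroup.zero_closed[OF J_subgroup])

lemma J_add: "x \<in> J \<Longrightarrow> y \<in> J \<Longrightarrow> x \<oplus> y \<in> J"
  by (rule additive_subgroup.a_closed[OF J_subgroup])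

lemma one_notin_J: "\<one> \<notin> J"
proof
  assume "\<one> \<in> J"
  then have "carrier A \<subseteq> J" using J_lmult[of _ \<one>] by auto
  then show False using J_maximal J_carrier by (auto simp: maximal_left_ideal_def)
qed

text \<open>If the left ideal generated by \<open>x\<close> were proper, it would lie in a maximal
  one, that is in \<open>J\<close>. So it contains \<open>\<one>\<close>, and the left inverse
  obtained is two-sided by finiteness.\<close>

lemma unit_if_notin_J:
  assumes "x \<in> carrier A" "x \<notin> J"
  obtains y where "y \<in> carrier A" "y \<otimes> x = \<one>" "x \<otimes> y = \<one>"
proof -
  let ?I = "(\<lambda>r. r \<otimes> x) ` carrier A"
  have xI: "x \<in> ?I" using assms by (intro image_eqI[of _ _ \<one>]) auto
  have "?I = carrier A"
  proof (rule ccontr)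
    assume "?I \<noteq> carrier A"
    then obtain M where "maximal_left_ideal A M" "?I \<subseteq> M"
      using left_ideal_in_maximal[OF finite_carrier left_ideal_principal] assms by blast
    then show False using xI assms(2) maximal_eq_J by blast
  qed
  then have "\<one> \<in> ?I" by simp
  then obtain y where "y \<in> carrier A" "y \<otimes> x = \<one>" by auto
  then show thesis
    using that finite_left_inverse_imp_right_inverse[OF finite_carrier] assms by blast
qed

text \<open>If \<open>x \<otimes> r\<close> had a left inverse \<open>y\<close>, then
  \<open>(y \<otimes> x) \<otimes> r = \<one>\<close>; swapping the factors gives
  \<open>(r \<otimes> y) \<otimes> x = \<one>\<close>, which puts \<open>\<one>\<close> into the
  left ideal \<open>J\<close>.\<close>

lemma J_rmult:
  assumes "x \<in> J" "r \<in> carrier A"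
  shows "x \<otimes> r \<in> J"
proof (rule ccontr)
  assume n: "x \<otimes> r \<notin> J"
  have x: "x \<in> carrier A" using assms J_carrier by auto
  obtain y where y: "y \<in> carrier A" "y \<otimes> (x \<otimes> r) = \<one>"
    using unit_if_notin_J[OF _ n] x assms by auto
  then have "r \<otimes> (y \<otimes> x) = \<one>"
    using finite_left_inverse_imp_right_inverse[OF finite_carrier, of r "y \<otimes> x"] x assms
    by (simp add: m_assoc)
  then show False using J_lmult[of "r \<otimes> y" x] y x assms one_notin_J by (simp add: m_assoc)
qed

text \<open>Nakayama's lemma for cyclic modules.\<close>
lemma eq_zero_if_J_fixes:
  assumes "m \<in> J" "x \<in> carrier A" "x = m \<otimes> x"
  shows "x = \<zero>"
proof -
  have m: "m \<in> carrier A" using assms J_carrier by auto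
  have "\<one> \<ominus> m \<notin> J"
  proof
    assume "\<one> \<ominus> m \<in> J"
    then have "(\<one> \<ominus> m) \<oplus> m \<in> J" using assms J_add by blast
    moreover have "(\<one> \<ominus> m) \<oplus> m = \<one>" using m by (simp add: minus_eq a_assoc l_neg)
    ultimately show False using one_notin_J by simp
  qed
  then obtain y where y: "y \<in> carrier A" "y \<otimes> (\<one> \<ominus> m) = \<one>"
    using unit_if_notin_J[of "\<one> \<ominus> m"] m by auto
  have "(\<one> \<ominus> m) \<otimes> x = x \<oplus> \<ominus> (m \<otimes> x)" using m assms(2) by (simp add: minus_eq l_distr l_minus)
  also have "\<dots> = \<zero>" using assms(2,3) by (metis r_neg)
  finally have "(y \<otimes> (\<one> \<ominus> m)) \<otimes> x = \<zero>" using y(1) m assms(2) by (simp add: m_assoc)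
  then show ?thesis using y assms by simp
qed

section \<open>The left socle\<close>

lemma socle_left_ideal: "left_ideal A L" and minimal_subset_socle: "minimal_left_ideal A I \<Longrightarrow> I \<subseteq> L"
proof -
  let ?S = "{K. left_ideal A K \<and> (\<forall>I. minimal_left_ideal A I \<longrightarrow> I \<subseteq> K)}"
  \<comment> \<open>The whole ring belongs to the family intersected in \<open>socle\<close>; an
    intersection over an empty family would be the universal set.\<close>
  have "left_ideal A (carrier A)"
    by (rule left_idealI) auto
  moreover have "I \<subseteq> carrier A" if "minimal_left_ideal A I" for I
    using that left_ideal_subset unfolding minimal_left_ideal_def by blast
  ultimately have c: "carrier A \<in> ?S" by auto
  show "left_ideal A L" unfolding socle_def
  proof (rule left_idealI)
    show "\<Inter> ?S \<subseteq> carrier A" using c by blast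
    show "\<zero> \<in> \<Inter> ?S"
      by (auto simp: left_ideal_def additive_subgroup.zero_closed)
    show "x \<oplus> y \<in> \<Inter> ?S" if "x \<in> \<Inter> ?S" "y \<in> \<Inter> ?S" for x y
      using that by (auto simp: left_ideal_def intro!: additive_subgroup.a_closed)
    show "r \<otimes> x \<in> \<Inter> ?S" if "r \<in> carrier A" "x \<in> \<Inter> ?S" for r x
      using that by (auto simp: left_ideal_def)
  qed
  show "I \<subseteq> L" if "minimal_left_ideal A I" using that unfolding socle_def by blast
qed

lemma L_subgroup: "additive_subgroup L A"
  by (rule left_idealD(1)[OF socle_left_ideal])

lemma L_carrier: "x \<in> L \<Longrightarrow> x \<in> carrier A"
  using additive_subgroup.a_subset[OF L_subgroup] by blast

lemma zero_L: "\<zero> \<in> L"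
  by (rule additive_subgroup.zero_closed[OF L_subgroup])

lemma L_lmult: "r \<in> carrier A \<Longrightarrow> x \<in> L \<Longrightarrow> r \<otimes> x \<in> L"
  by (rule left_idealD(2)[OF socle_left_ideal])

text \<open>For \<open>a\<close> nonzero, any nonzero \<open>r \<otimes> a\<close> has
  \<open>r\<close> outside \<open>J\<close>, so \<open>r\<close> is a unit and \<open>a\<close> is
  recovered from \<open>r \<otimes> a\<close>. Hence the left ideal generated by \<open>a\<close> is
  minimal.\<close>

lemma in_socle_if_J_annihilates:
  assumes a: "a \<in> carrier A" and Ja: "\<And>m. m \<in> J \<Longrightarrow> m \<otimes> a = \<zero>"
  shows "a \<in> L"
proof (cases "a = \<zero>")
  case True
  then show ?thesis using zero_L by simp
next
  case False
  let ?I = "(\<lambda>r. r \<otimes> a) ` carrier A"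
  have aI: "a \<in> ?I" using a by (intro image_eqI[of _ _ \<one>]) auto
  have "minimal_left_ideal A ?I" unfolding minimal_left_ideal_def
  proof (intro conjI allI impI)
    show "left_ideal A ?I" using left_ideal_principal a .
    show "?I \<noteq> {\<zero>}" using aI False by blast
    fix K assume K: "left_ideal A K \<and> K \<subseteq> ?I"
    show "K = {\<zero>} \<or> K = ?I"
    proof (rule disjCI)
      assume "K \<noteq> ?I"
      have z: "\<zero> \<in> K" using K by (simp add: left_ideal_def additive_subgroup.zero_closed)
      have "y = \<zero>" if yK: "y \<in> K" for y
      proof (rule ccontr)
        assume "y \<noteq> \<zero>"
        obtain r where r: "r \<in> carrier A" "y = r \<otimes> a" using yK K by auto
        then have "r \<notin> J" using Ja \<open>y \<noteq> \<zero>\<close> by auto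
        then obtain s where s: "s \<in> carrier A" "s \<otimes> r = \<one>" using unit_if_notin_J[OF r(1)] by blast
        then have "s \<otimes> y = a" using r a by (simp add: m_assoc[symmetric])
        then have "a \<in> K" using left_idealD(2)[of A K s y] K s yK by auto
        then have "?I \<subseteq> K" using left_idealD(2)[of A K] K by auto
        then show False using K \<open>K \<noteq> ?I\<close> by auto
      qed
      then show "K = {\<zero>}" using z by blast
    qed
  qed
  then show ?thesis using minimal_subset_socle aI by blast
qed

end

text \<open>Equality of the cardinalities of residue field and socle makes the socle a simple module.\<close>
locale finite_local_ring_q = finite_local_ring A for A (structure) +
  fixes q :: nat
  assumes card_quot: "card (carrier (A Quot jacobson_rad A)) = q"
    and card_socle: "card (socle A) = q"
begin

lemma card_carrier: "card (carrier A) = q * card J"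
  using a_lagrange[OF finite_carrier J_subgroup] card_quot
  by (simp add: FactRing_def Coset.order_def)

text \<open>A minimal left ideal \<open>I\<close> is generated by some \<open>x\<close> whose
  annihilator is exactly \<open>J\<close>, so \<open>I\<close> has at least as many elements as the
  quotient by \<open>J\<close>, namely \<open>q\<close>. As \<open>I\<close> lies in the socle,
  which has \<open>q\<close> elements, the two are equal.\<close>

lemma socle_cyclic:
  obtains x where "x \<in> L" "x \<noteq> \<zero>" "\<And>m. m \<in> J \<Longrightarrow> m \<otimes> x = \<zero>" "L = (\<lambda>r. r \<otimes> x) ` carrier A"
proof -
  have "left_ideal A (carrier A)" by (rule left_idealI) auto
  moreover have "carrier A \<noteq> {\<zero>}" using one_closed one_notin_J zero_J by (metis singletonD)
  ultimately obtain I where I: "minimal_left_ideal A I"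
    using minimal_left_ideal_in[OF finite_carrier] by blast
  have Il: "left_ideal A I" using I by (simp add: minimal_left_ideal_def)
  have Ic: "I \<subseteq> carrier A" using Il left_ideal_subset by blast
  have "\<zero> \<in> I" using Il by (simp add: left_ideal_def additive_subgroup.zero_closed)
  then obtain x where x: "x \<in> I" "x \<noteq> \<zero>" using I unfolding minimal_left_ideal_def by blast
  have xc: "x \<in> carrier A" using x Ic by auto
  have gen: "(\<lambda>r. r \<otimes> y) ` carrier A = I" if y: "y \<in> I" "y \<noteq> \<zero>" for y
  proof -
    have yc: "y \<in> carrier A" using y Ic by auto
    have "y \<in> (\<lambda>r. r \<otimes> y) ` carrier A" using yc by (intro image_eqI[of _ _ \<one>]) auto
    moreover have "(\<lambda>r. r \<otimes> y) ` carrier A \<subseteq> I" using y left_idealD(2)[OF Il] by auto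
    ultimately show ?thesis
      using I left_ideal_principal[OF yc] y unfolding minimal_left_ideal_def by blast
  qed
  \<comment> \<open>If \<open>m \<otimes> x\<close> were nonzero it would generate \<open>I\<close>,
    so \<open>x = (r \<otimes> m) \<otimes> x\<close> for some \<open>r\<close>, which Nakayama's
    lemma forbids.\<close>
  have Jx: "m \<otimes> x = \<zero>" if m: "m \<in> J" for m
  proof (rule ccontr)
    assume nz: "m \<otimes> x \<noteq> \<zero>"
    have mc: "m \<in> carrier A" using m J_carrier by auto
    have "m \<otimes> x \<in> I" using left_idealD(2)[OF Il] mc x by auto
    then have "x \<in> (\<lambda>r. r \<otimes> (m \<otimes> x)) ` carrier A" using gen nz x by blast
    then obtain r where r: "r \<in> carrier A" "x = r \<otimes> (m \<otimes> x)" by auto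
    then have "x = (r \<otimes> m) \<otimes> x" using mc xc by (simp add: m_assoc)
    then show False using eq_zero_if_J_fixes[of "r \<otimes> m" x] J_lmult r m xc x by auto
  qed
  have ann: "r \<in> J" if r: "r \<in> carrier A" "r \<otimes> x = \<zero>" for r
  proof (rule ccontr)
    assume "r \<notin> J"
    then obtain s where s: "s \<in> carrier A" "s \<otimes> r = \<one>" using unit_if_notin_J[OF r(1)] by blast
    then have "s \<otimes> (r \<otimes> x) = x" using r(1) xc by (simp add: m_assoc[symmetric])
    then show False using r s x by simp
  qed
  interpret J: abelian_subgroup J A
    by (rule abelian_subgroupI3[OF J_subgroup]) (rule abelian_group_axioms)
  \<comment> \<open>For the cardinality bound a surjection from \<open>I\<close> onto the cosets
    suffices: \<open>y\<close> goes to the coset of some chosen \<open>r\<close> with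
    \<open>y = r \<otimes> x\<close>. The choice does not matter, since two candidates differ by an
    annihilator of \<open>x\<close>, that is by an element of \<open>J\<close>.\<close>
  have "a_rcosets J \<subseteq> (\<lambda>y. J +> (SOME r. r \<in> carrier A \<and> y = r \<otimes> x)) ` I"
  proof
    fix C assume "C \<in> a_rcosets J"
    then obtain r where r: "r \<in> carrier A" "C = J +> r" by (auto simp: A_RCOSETS_def')
    define s where "s = (SOME s. s \<in> carrier A \<and> r \<otimes> x = s \<otimes> x)"
    have "s \<in> carrier A \<and> r \<otimes> x = s \<otimes> x" unfolding s_def by (rule someI[of _ r]) (use r in auto)
    then have s: "s \<in> carrier A" "r \<otimes> x = s \<otimes> x" by auto
    have "(s \<ominus> r) \<otimes> x = \<zero>" using s r xc by (simp add: minus_eq l_distr l_minus r_neg)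
    then have "s \<ominus> r \<in> J" using ann s r by auto
    moreover have "(s \<ominus> r) \<oplus> r = s" using s r by (simp add: minus_eq a_assoc l_neg)
    ultimately have "s \<in> J +> r" using a_rcosI[of "s \<ominus> r" J r] r J.a_subset by auto
    then have "C = J +> s" using a_repr_independence r J.a_subgroup by auto
    moreover have "r \<otimes> x \<in> I" using gen x r by blast
    ultimately show "C \<in> (\<lambda>y. J +> (SOME r. r \<in> carrier A \<and> y = r \<otimes> x)) ` I"
      unfolding s_def by (intro image_eqI[of _ _ "r \<otimes> x"]) auto
  qed
  then have "card (a_rcosets J) \<le> card I"
    using finite_subset[OF Ic finite_carrier] by (rule surj_card_le[rotated])
  then have "card L \<le> card I" using card_quot card_socle by (simp add: FactRing_def)
  moreover have "finite L" using L_carrier finite_subset[OF _ finite_carrier] by blast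
  ultimately have "I = L" using minimal_subset_socle[OF I] card_seteq by blast
  then show thesis using that x Jx gen by blast
qed

lemma one_less_q: "1 < q"
proof -
  obtain x where "x \<in> L" "x \<noteq> \<zero>" using socle_cyclic by blast
  then have "card {\<zero>, x} \<le> card L"
    using zero_L L_carrier finite_subset[OF _ finite_carrier] by (intro card_mono) auto
  then show ?thesis using \<open>x \<noteq> \<zero>\<close> card_socle by simp
qed

text \<open>Only the generator \<open>x\<close> is known to be killed by \<open>J\<close>. For
  \<open>y = r \<otimes> x\<close> the factor \<open>m \<otimes> r\<close> is again in
  \<open>J\<close>, because the radical is two-sided.\<close>

lemma J_socle_zero:
  assumes "m \<in> J" "y \<in> L"
  shows "m \<otimes> y = \<zero>"
proof -
  obtain x where x: "x \<in> L" "\<And>m. m \<in> J \<Longrightarrow> m \<otimes> x = \<zero>" "L = (\<lambda>r. r \<otimes> x) ` carrier A"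
    using socle_cyclic by metis
  obtain r where r: "r \<in> carrier A" "y = r \<otimes> x" using assms x by auto
  have "m \<otimes> y = (m \<otimes> r) \<otimes> x" using r x L_carrier assms J_carrier by (simp add: m_assoc)
  then show ?thesis using x(2) J_rmult assms r by simp
qed

text \<open>Being annihilated by \<open>J\<close> from the left is stable under right
  multiplication, and it characterizes the socle. This makes the left socle a two-sided
  ideal.\<close>

lemma socle_rmult:
  assumes "y \<in> L" "a \<in> carrier A"
  shows "y \<otimes> a \<in> L"
proof (rule in_socle_if_J_annihilates)
  show "y \<otimes> a \<in> carrier A" using assms L_carrier by auto
  fix m assume "m \<in> J"
  then have "m \<otimes> (y \<otimes> a) = (m \<otimes> y) \<otimes> a" using assms L_carrier J_carrier by (simp add: m_assoc)
  then show "m \<otimes> (y \<otimes> a) = \<zero>" using J_socle_zero \<open>m \<in> J\<close> assms by simp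
qed

text \<open>Simplicity of the socle: a nonzero \<open>y = r \<otimes> x\<close> has \<open>r\<close>
  invertible, so the generator \<open>x\<close> can be recovered from \<open>y\<close>.\<close>

lemma socle_generator:
  assumes "y \<in> L" "y \<noteq> \<zero>" "z \<in> L"
  shows "\<exists>r\<in>carrier A. z = r \<otimes> y"
proof -
  obtain x where x: "x \<in> L" "\<And>m. m \<in> J \<Longrightarrow> m \<otimes> x = \<zero>" "L = (\<lambda>r. r \<otimes> x) ` carrier A"
    using socle_cyclic by metis
  have xc: "x \<in> carrier A" using x L_carrier by auto
  obtain r where r: "r \<in> carrier A" "y = r \<otimes> x" using assms x by auto
  obtain u where u: "u \<in> carrier A" "z = u \<otimes> x" using assms x by auto
  have "r \<notin> J" using x r assms by auto
  then obtain s where s: "s \<in> carrier A" "s \<otimes> r = \<one>" using unit_if_notin_J[OF r(1)] by blast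
  have "(u \<otimes> s) \<otimes> y = u \<otimes> ((s \<otimes> r) \<otimes> x)" using r xc u s(1) by (simp add: m_assoc)
  then show ?thesis using u s xc by (intro bexI[of _ "u \<otimes> s"]) auto
qed

text \<open>If some element of the socle were not annihilated by \<open>a \<in> J\<close> on the right, then neither
  by \<open>a\<^sup>2\<close>, while \<open>R a\<^sup>2\<close> is strictly smaller than \<open>R a\<close> by Nakayama's lemma.\<close>
lemma socle_J_zero:
  assumes "y \<in> L" "a \<in> J"
  shows "y \<otimes> a = \<zero>"
  using assms
proof (induction "card ((\<lambda>r. r \<otimes> a) ` carrier A)" arbitrary: a y rule: less_induct)
  case (less a y)
  let ?I = "\<lambda>a. (\<lambda>r. r \<otimes> a) ` carrier A"
  have c: "a \<in> carrier A" "y \<in> carrier A" using less.prems L_carrier J_carrier by auto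
  show ?case
  proof (rule ccontr)
    assume nz: "y \<otimes> a \<noteq> \<zero>"
    then obtain r where r: "r \<in> carrier A" "y = r \<otimes> (y \<otimes> a)"
      using socle_generator[of "y \<otimes> a" y] socle_rmult less.prems c by blast
    have "r \<otimes> (y \<otimes> (a \<otimes> a)) = (r \<otimes> (y \<otimes> a)) \<otimes> a" using r(1) c by (simp add: m_assoc)
    then have eq: "r \<otimes> (y \<otimes> (a \<otimes> a)) = y \<otimes> a" using r by simp
    have "?I (a \<otimes> a) \<subset> ?I a"
    proof
      show "?I (a \<otimes> a) \<subseteq> ?I a"
      proof
        fix z assume "z \<in> ?I (a \<otimes> a)"
        then obtain s where "s \<in> carrier A" "z = s \<otimes> (a \<otimes> a)" by auto
        then show "z \<in> ?I a" using c by (intro image_eqI[of _ _ "s \<otimes> a"]) (auto simp: m_assoc)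
      qed
      show "?I (a \<otimes> a) \<noteq> ?I a"
      proof
        assume "?I (a \<otimes> a) = ?I a"
        moreover have "a \<in> ?I a" using c by (intro image_eqI[of _ _ \<one>]) auto
        ultimately obtain s where s: "s \<in> carrier A" "a = s \<otimes> (a \<otimes> a)" by auto
        then have "a = (s \<otimes> a) \<otimes> a" using c by (simp add: m_assoc)
        then have "a = \<zero>" using eq_zero_if_J_fixes[of "s \<otimes> a" a] J_lmult s less.prems c by auto
        then show False using nz c by simp
      qed
    qed
    then have "card (?I (a \<otimes> a)) < card (?I a)"
      using finite_carrier by (intro psubset_card_mono) auto
    then have "y \<otimes> (a \<otimes> a) = \<zero>" using less.hyps less.prems J_lmult c by blast
    then show False using eq nz r by simp
  qed
qed

end

section \<open>Character sums over finite local rings\<close>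

text \<open>Orthogonality: translation by \<open>h\<close> with \<open>g h \<noteq> 1\<close>
  permutes \<open>H\<close> and multiplies the sum by \<open>g h\<close>, so the sum is 0.\<close>

lemma (in ring) character_sum:
  fixes g :: "'a \<Rightarrow> complex"
  assumes H: "additive_subgroup H R" and fin: "finite H"
    and g: "\<And>x y. x \<in> H \<Longrightarrow> y \<in> H \<Longrightarrow> g (x \<oplus> y) = g x * g y"
  shows "(\<Sum>x\<in>H. g x) = (if \<forall>x\<in>H. g x = 1 then of_nat (card H) else 0)"
proof (cases "\<forall>x\<in>H. g x = 1")
  case False
  then obtain h where h: "h \<in> H" "g h \<noteq> 1" by auto
  have sub: "H \<subseteq> carrier R" using additive_subgroup.a_subset[OF H] .
  have inj: "inj_on (\<lambda>x. x \<oplus> h) H" using sub h by (intro inj_onI) (meson add.right_cancel subsetD)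
  have "(\<lambda>x. x \<oplus> h) ` H = H"
    using h additive_subgroup.a_closed[OF H] by (intro endo_inj_surj fin inj) auto
  then have "(\<Sum>x\<in>H. g x) = (\<Sum>x\<in>H. g (x \<oplus> h))"
    using sum.reindex[OF inj, of g] by (simp add: o_def)
  also have "\<dots> = (\<Sum>x\<in>H. g x) * g h" using g h by (simp add: sum_distrib_right)
  finally have "(\<Sum>x\<in>H. g x) = 0" using h by simp
  then show ?thesis using False by auto
qed simp

text \<open>Nondegeneracy is assumed on one side only, in the form that a component inherits from
  the injectivity of a generating character: \<open>f\<close> is nontrivial on every nonzero
  principal left ideal.\<close>

locale finite_local_ring_char = finite_local_ring_q A q for A (structure) and q +
  fixes f :: "'a \<Rightarrow> complex"
  assumes f_add: "\<And>x y. x \<in> carrier A \<Longrightarrow> y \<in> carrier A \<Longrightarrow> f (x \<oplus> y) = f x * f y"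
    and f_zero: "f \<zero> = 1"
    and f_left: "\<And>x. x \<in> carrier A \<Longrightarrow> x \<noteq> \<zero> \<Longrightarrow> \<exists>r\<in>carrier A. f (r \<otimes> x) \<noteq> 1"
begin

lemma carrier_subgroup: "additive_subgroup (carrier A) A"
  by (simp add: additive_subgroup_def add.subgroup_self)

lemma finite_L: "finite L" and finite_J: "finite J"
  using L_carrier J_carrier finite_subset[OF _ finite_carrier] by blast+

lemma sum_rmult:
  assumes H: "additive_subgroup H A" and a: "a \<in> carrier A"
  shows "(\<Sum>b\<in>H. f (b \<otimes> a)) = (if \<forall>b\<in>H. f (b \<otimes> a) = 1 then of_nat (card H) else 0)"
proof (rule character_sum[OF H])
  have sub: "H \<subseteq> carrier A" using additive_subgroup.a_subset[OF H] .
  then show "finite H" using finite_carrier finite_subset by blast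
  show "f ((x \<oplus> y) \<otimes> a) = f (x \<otimes> a) * f (y \<otimes> a)" if "x \<in> H" "y \<in> H" for x y
    using that sub a by (subst l_distr) (auto intro!: f_add)
qed

lemma sum_lmult:
  assumes H: "additive_subgroup H A" and a: "a \<in> carrier A"
  shows "(\<Sum>b\<in>H. f (a \<otimes> b)) = (if \<forall>b\<in>H. f (a \<otimes> b) = 1 then of_nat (card H) else 0)"
proof (rule character_sum[OF H])
  have sub: "H \<subseteq> carrier A" using additive_subgroup.a_subset[OF H] .
  then show "finite H" using finite_carrier finite_subset by blast
  show "f (a \<otimes> (x \<oplus> y)) = f (a \<otimes> x) * f (a \<otimes> y)" if "x \<in> H" "y \<in> H" for x y
    using that sub a by (subst r_distr) (auto intro!: f_add)
qed

lemma sum_carrier_rmult: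
  assumes a: "a \<in> carrier A"
  shows "(\<Sum>b\<in>carrier A. f (b \<otimes> a)) = (if a = \<zero> then of_nat (card (carrier A)) else 0)"
  using sum_rmult[OF carrier_subgroup a] f_left[OF a] f_zero by auto

text \<open>Double counting \<open>\<Sum>x b. f (x b)\<close> transfers nondegeneracy from one side to the other.\<close>
lemma f_right:
  assumes a: "a \<in> carrier A" "a \<noteq> \<zero>"
  shows "\<exists>r\<in>carrier A. f (a \<otimes> r) \<noteq> 1"
proof (rule ccontr)
  assume "\<not> ?thesis"
  then have tr: "\<forall>b\<in>carrier A. f (a \<otimes> b) = 1" by auto
  let ?T = "{x \<in> carrier A. \<forall>b\<in>carrier A. f (x \<otimes> b) = 1}"
  let ?N = "of_nat (card (carrier A)) :: complex"
  have N: "?N \<noteq> 0" using finite_carrier by (auto simp: card_eq_0_iff)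
  have "of_nat (card ?T) * ?N = (\<Sum>x\<in>carrier A. if \<forall>b\<in>carrier A. f (x \<otimes> b) = 1 then ?N else 0)"
    using finite_carrier by (simp add: sum.If_cases Int_def)
  also have "\<dots> = (\<Sum>x\<in>carrier A. \<Sum>b\<in>carrier A. f (x \<otimes> b))"
    using sum_lmult[OF carrier_subgroup] by (intro sum.cong) auto
  also have "\<dots> = (\<Sum>b\<in>carrier A. \<Sum>x\<in>carrier A. f (x \<otimes> b))" by (rule sum.swap)
  also have "\<dots> = (\<Sum>b\<in>carrier A. if b = \<zero> then ?N else 0)"
    using sum_carrier_rmult by (intro sum.cong) auto
  also have "\<dots> = ?N" using finite_carrier by simp
  finally have "of_nat (card ?T) = (1 :: complex)" using N by simp
  then have "card ?T = 1" using of_nat_eq_1_iff by blast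
  have "{\<zero>, a} \<subseteq> ?T" using a tr f_zero by auto
  then have "card {\<zero>, a} \<le> card ?T" using finite_carrier by (intro card_mono) auto
  then show False using a \<open>card ?T = 1\<close> by simp
qed

lemma sum_carrier_lmult:
  assumes a: "a \<in> carrier A"
  shows "(\<Sum>b\<in>carrier A. f (a \<otimes> b)) = (if a = \<zero> then of_nat (card (carrier A)) else 0)"
  using sum_lmult[OF carrier_subgroup a] f_right[OF a] f_zero by auto

lemma f_socle_nontrivial: "\<exists>y\<in>L. f y \<noteq> 1"
proof -
  obtain x where x: "x \<in> L" "x \<noteq> \<zero>" using socle_cyclic by metis
  then obtain r where "r \<in> carrier A" "f (r \<otimes> x) \<noteq> 1" using f_left L_carrier by blast
  then show ?thesis using L_lmult x by blast
qed

text \<open>An \<open>a\<close> in \<open>J\<close> kills the socle. Any other \<open>a\<close> is a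
  unit, so multiplication by \<open>a\<close> maps the socle onto itself, where \<open>f\<close> is
  nontrivial.\<close>

lemma sum_socle_lmult:
  assumes a: "a \<in> carrier A"
  shows "(\<Sum>b\<in>L. f (a \<otimes> b)) = (if a \<in> J then of_nat q else 0)"
proof -
  have "(\<forall>b\<in>L. f (a \<otimes> b) = 1) \<longleftrightarrow> a \<in> J"
  proof
    assume tr: "\<forall>b\<in>L. f (a \<otimes> b) = 1"
    show "a \<in> J"
    proof (rule ccontr)
      assume "a \<notin> J"
      then obtain s where s: "s \<in> carrier A" "a \<otimes> s = \<one>" using unit_if_notin_J[OF a] by blast
      obtain y where y: "y \<in> L" "f y \<noteq> 1" using f_socle_nontrivial by auto
      have "a \<otimes> (s \<otimes> y) = y" using s a y L_carrier by (simp add: m_assoc[symmetric])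
      then show False using tr L_lmult[OF s(1) y(1)] y by metis
    qed
  qed (use J_socle_zero f_zero in auto)
  then show ?thesis using sum_lmult[OF L_subgroup a] card_socle by simp
qed

text \<open>The mirror image needs both right-hand facts about the left socle:
  \<open>socle_rmult\<close> for units \<open>a\<close> and \<open>socle_J_zero\<close> for
  \<open>a\<close> in the radical.\<close>

lemma sum_socle_rmult:
  assumes a: "a \<in> carrier A"
  shows "(\<Sum>b\<in>L. f (b \<otimes> a)) = (if a \<in> J then of_nat q else 0)"
proof -
  have "(\<forall>b\<in>L. f (b \<otimes> a) = 1) \<longleftrightarrow> a \<in> J"
  proof
    assume tr: "\<forall>b\<in>L. f (b \<otimes> a) = 1"
    show "a \<in> J"
    proof (rule ccontr)
      assume "a \<notin> J"
      then obtain s where s: "s \<in> carrier A" "s \<otimes> a = \<one>" using unit_if_notin_J[OF a] by blast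
      obtain y where y: "y \<in> L" "f y \<noteq> 1" using f_socle_nontrivial by auto
      have "(y \<otimes> s) \<otimes> a = y" using s a y L_carrier by (simp add: m_assoc)
      then show False using tr socle_rmult[OF y(1) s(1)] y by metis
    qed
  qed (use socle_J_zero f_zero in auto)
  then show ?thesis using sum_rmult[OF L_subgroup a] card_socle by simp
qed

text \<open>If some \<open>m \<otimes> a\<close> with \<open>m\<close> in \<open>J\<close> were
  nonzero, \<open>f\<close> would be nontrivial on its left multiples, which are again of the form
  \<open>m' \<otimes> a\<close> with \<open>m'\<close> in \<open>J\<close>. So triviality of
  \<open>f\<close> there means that \<open>J\<close> annihilates \<open>a\<close>.\<close>

lemma sum_rad_rmult:
  assumes a: "a \<in> carrier A"
  shows "(\<Sum>b\<in>J. f (b \<otimes> a)) = (if a \<in> L then of_nat (card J) else 0)"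
proof -
  have "(\<forall>b\<in>J. f (b \<otimes> a) = 1) \<longleftrightarrow> a \<in> L"
  proof
    assume tr: "\<forall>b\<in>J. f (b \<otimes> a) = 1"
    show "a \<in> L"
    proof (rule in_socle_if_J_annihilates[OF a], rule ccontr)
      fix m assume m: "m \<in> J" "m \<otimes> a \<noteq> \<zero>"
      then obtain r where r: "r \<in> carrier A" "f (r \<otimes> (m \<otimes> a)) \<noteq> 1"
        using f_left[of "m \<otimes> a"] a J_carrier by auto
      have "(r \<otimes> m) \<otimes> a = r \<otimes> (m \<otimes> a)" using r(1) m(1) a J_carrier by (simp add: m_assoc)
      then show False using tr J_lmult[OF r(1) m(1)] r(2) by auto
    qed
  qed (use J_socle_zero f_zero in auto)
  then show ?thesis using sum_rmult[OF J_subgroup a] by simp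
qed

lemma sum_socle_nonzero_lmult:
  assumes a: "a \<in> carrier A"
  shows "(\<Sum>b\<in>{b \<in> L. b \<noteq> \<zero>}. f (a \<otimes> b)) = (if a \<in> J then of_nat q - 1 else - 1)"
proof -
  have "{b \<in> L. b \<noteq> \<zero>} = L - {\<zero>}" by auto
  then show ?thesis
    using sum_diff1[OF finite_L, of "\<lambda>b. f (a \<otimes> b)" \<zero>] zero_L f_zero a sum_socle_lmult[OF a] by auto
qed

lemma sum_socle_nonzero_rmult:
  assumes a: "a \<in> carrier A"
  shows "(\<Sum>b\<in>{b \<in> L. b \<noteq> \<zero>}. f (b \<otimes> a)) = (if a \<in> J then of_nat q - 1 else - 1)"
proof -
  have "{b \<in> L. b \<noteq> \<zero>} = L - {\<zero>}" by auto
  then show ?thesis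
    using sum_diff1[OF finite_L, of "\<lambda>b. f (b \<otimes> a)" \<zero>] zero_L f_zero a sum_socle_rmult[OF a] by auto
qed

text \<open>This is the sum over the ring minus the sum over \<open>J\<close>. For
  \<open>a = \<zero>\<close> it is |A| - |J|, which \<open>card_carrier\<close> turns into |J| (q -
  1). Up to the common factor |J| the values for \<open>a\<close> in the socle agree with those of
  the nonzero socle sums, so the same polynomials arise.\<close>

lemma sum_nonrad_rmult:
  assumes a: "a \<in> carrier A"
  shows "(\<Sum>b\<in>{b \<in> carrier A. b \<notin> J}. f (b \<otimes> a)) =
    (if a \<in> L then of_nat (card J) * (if a = \<zero> then of_nat q - 1 else - 1) else 0)"
proof -
  have "{b \<in> carrier A. b \<notin> J} = carrier A - J" by auto
  moreover have "J \<subseteq> carrier A" using J_carrier by auto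
  ultimately show ?thesis
    using sum_diff[OF finite_carrier, of J "\<lambda>b. f (b \<otimes> a)"] sum_carrier_rmult[OF a] sum_rad_rmult[OF a]
      card_carrier zero_L by (auto simp: algebra_simps eq_neg_iff_add_eq_0)
qed

end

section \<open>Weight enumerators\<close>

text \<open>Generating function: the indeterminate marks the coordinates where \<open>P\<close>
  holds. Each \<open>y\<close> becomes a monomial of degree 1 or 0, and expanding the product of
  sums gives one monomial per tuple, whose degree is the weight of the tuple.\<close>

lemma coeff_prod_sum_weight:
  fixes F :: "nat \<Rightarrow> 'b \<Rightarrow> complex"
  assumes fin: "\<And>j. j < N \<Longrightarrow> finite (B j)"
  shows "(\<Sum>x\<in>{x \<in> (\<Pi>\<^sub>E j\<in>{..<N}. B j). card {j. j < N \<and> P j (x j)} = k}. \<Prod>j<N. F j (x j)) =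
    coeff (\<Prod>j<N. [:\<Sum>y\<in>{y \<in> B j. \<not> P j y}. F j y, \<Sum>y\<in>{y \<in> B j. P j y}. F j y:]) k"
proof -
  have finP: "finite (\<Pi>\<^sub>E j\<in>{..<N}. B j)" using fin by (intro finite_PiE) auto
  define G where "G = (\<lambda>j y. monom (F j y) (if P j y then 1 else 0))"
  have lin: "[:\<Sum>y\<in>{y \<in> B j. \<not> P j y}. F j y, \<Sum>y\<in>{y \<in> B j. P j y}. F j y:] = (\<Sum>y\<in>B j. G j y)"
    if j: "j < N" for j
  proof -
    have "(\<Sum>y\<in>B j. G j y) = (\<Sum>y\<in>{y \<in> B j. \<not> P j y}. G j y) + (\<Sum>y\<in>{y \<in> B j. P j y}. G j y)"
      using fin[OF j] by (subst sum.union_disjoint[symmetric]) (auto intro!: sum.cong)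
    also have "(\<Sum>y\<in>{y \<in> B j. \<not> P j y}. G j y) = monom (\<Sum>y\<in>{y \<in> B j. \<not> P j y}. F j y) 0"
      by (simp add: G_def monom_sum)
    also have "(\<Sum>y\<in>{y \<in> B j. P j y}. G j y) = monom (\<Sum>y\<in>{y \<in> B j. P j y}. F j y) 1"
      by (simp add: G_def monom_sum)
    finally show ?thesis by (simp add: monom_0 monom_Suc)
  qed
  have mono: "(\<Prod>j<M. G j (x j)) = monom (\<Prod>j<M. F j (x j)) (card {j. j < M \<and> P j (x j)})" for x M
  proof (induction M)
    case (Suc M)
    have "{j. j < Suc M \<and> P j (x j)} =
        (if P M (x M) then insert M {j. j < M \<and> P j (x j)} else {j. j < M \<and> P j (x j)})"
      using less_Suc_eq by auto
    then show ?case using Suc by (simp add: G_def mult_monom)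
  qed (simp add: monom_0 one_pCons)
  have "(\<Prod>j<N. [:\<Sum>y\<in>{y \<in> B j. \<not> P j y}. F j y, \<Sum>y\<in>{y \<in> B j. P j y}. F j y:])
      = (\<Prod>j<N. \<Sum>y\<in>B j. G j y)" using lin by (intro prod.cong) auto
  also have "\<dots> = (\<Sum>x\<in>(\<Pi>\<^sub>E j\<in>{..<N}. B j). \<Prod>j<N. G j (x j))"
    using fin by (intro prod_sum_PiE) auto
  finally show ?thesis
    using finP by (simp add: mono coeff_sum coeff_monom sum.If_cases Int_def)
qed

text \<open>The coefficients of this polynomial are the values at \<open>w\<close> of the Krawtchouk polynomials.\<close>
definition krawtchouk :: "nat \<Rightarrow> nat \<Rightarrow> nat \<Rightarrow> complex poly" where
  "krawtchouk q N w = [:1, of_nat q - 1:] ^ (N - w) * [:1, - 1:] ^ w"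

lemma coeff_0_krawtchouk: "coeff (krawtchouk q N w) 0 = 1"
  by (simp add: krawtchouk_def coeff_mult_0 coeff_0_power)

text \<open>Weights only run up to \<open>N\<close>; this bound ensures that the coefficients with
  those indices determine the polynomial.\<close>

lemma degree_krawtchouk: "w \<le> N \<Longrightarrow> degree (krawtchouk q N w) \<le> N"
proof -
  assume w: "w \<le> N"
  have "degree (krawtchouk q N w) \<le> degree ([:1, of_nat q - 1:] ^ (N - w) :: complex poly) +
      degree ([:1, - 1:] ^ w :: complex poly)"
    unfolding krawtchouk_def by (rule degree_mult_le)
  also have "\<dots> \<le> degree [:1, of_nat q - 1 :: complex:] * (N - w) + degree [:1, - 1 :: complex:] * w"
    by (intro add_mono degree_power_le)
  also have "\<dots> \<le> 1 * (N - w) + 1 * w" by (intro add_mono mult_right_mono) auto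
  finally show ?thesis using w by simp
qed

text \<open>For \<open>u < v\<close>, cancelling the common factors leaves
  \<open>(1 + (q - 1) X)\<close> and \<open>(1 - X)\<close> with the same positive exponent
  \<open>v - u\<close>. At X = 1 one power is positive and the other is 0.\<close>

lemma krawtchouk_inj:
  assumes q: "0 < q" and "w \<le> N" "w' \<le> N" and eq: "krawtchouk q N w = krawtchouk q N w'"
  shows "w = w'"
proof -
  have False if w: "u < v" "v \<le> N" and e: "krawtchouk q N u = krawtchouk q N v" for u v
  proof -
    let ?a = "[:1, of_nat q - 1:] :: complex poly" and ?b = "[:1, - 1:] :: complex poly"
    have "?a ^ (N - u) = ?a ^ (N - v) * ?a ^ (v - u)" using w by (simp add: power_add[symmetric])
    moreover have "?b ^ v = ?b ^ u * ?b ^ (v - u)" using w by (simp add: power_add[symmetric])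
    ultimately have "(?a ^ (N - v) * ?b ^ u) * ?a ^ (v - u) = (?a ^ (N - v) * ?b ^ u) * ?b ^ (v - u)"
      using e unfolding krawtchouk_def by (simp only: ac_simps)
    then have "?a ^ (v - u) = ?b ^ (v - u)" by (subst (asm) mult_cancel_left) auto
    then have "poly (?a ^ (v - u)) 1 = poly (?b ^ (v - u)) 1" by simp
    then show False using q w by (simp add: poly_power zero_power)
  qed
  from this[of w w'] this[of w' w] show ?thesis
    using assms by (cases w w' rule: linorder_cases) auto
qed

text \<open>The scaling factors \<open>c j\<close> let one computation serve both directions: they
  are 1 for sums over the socle and the size of the radical for sums over the whole
  component.\<close>

lemma prod_krawtchouk:
  fixes u v :: "nat \<Rightarrow> complex"
  assumes "\<And>j. j < N \<Longrightarrow> u j = c j"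
    and "\<And>j. j < N \<Longrightarrow> v j = c j * (if P j then - 1 else of_nat q - 1)"
  shows "(\<Prod>j<N. [:u j, v j:]) = smult (\<Prod>j<N. c j) (krawtchouk q N (card {j. j < N \<and> P j}))"
proof -
  have "(\<Prod>j<N. [:u j, v j:]) = (\<Prod>j<N. smult (c j) (if P j then [:1, - 1:] else [:1, of_nat q - 1:]))"
    using assms by (intro prod.cong) auto
  also have "\<dots> = smult (\<Prod>j<N. c j) (\<Prod>j<N. if P j then [:1, - 1:] else [:1, of_nat q - 1:])"
    by (rule prod_smult)
  also have "(\<Prod>j<N. if P j then [:1, - 1:] else [:1, of_nat q - 1 :: complex:]) =
      [:1, - 1:] ^ card {j. j < N \<and> P j} * [:1, of_nat q - 1:] ^ card {j. j < N \<and> \<not> P j}"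
    by (simp add: prod.If_cases Int_def Collect_conj_eq[symmetric] lessThan_def)
  also have "card {j. j < N \<and> \<not> P j} = N - card {j. j < N \<and> P j}"
  proof -
    have "{j. j < N \<and> \<not> P j} = {..<N} - {j. j < N \<and> P j}" by auto
    moreover have "card ({..<N} - {j. j < N \<and> P j}) = card {..<N} - card {j. j < N \<and> P j}"
      by (rule card_Diff_subset) auto
    ultimately show ?thesis by simp
  qed
  finally show ?thesis by (simp add: krawtchouk_def mult.commute)
qed

text \<open>Equality of products does not split into factors by itself. Varying \<open>m\<close> at
  one position \<open>i\<close> and keeping it 0 elsewhere isolates one factor, since all constant
  coefficients are 1.\<close>

lemma prod_coeff_krawtchouk_inj:
  assumes eq: "\<And>m. m \<in> idx_set t n \<Longrightarrow>
      (\<Prod>i<t. coeff (krawtchouk (q i) (n i) (w i)) (m i)) = (\<Prod>i<t. coeff (krawtchouk (q i) (n i) (w' i)) (m i))"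
    and w: "\<And>i. i < t \<Longrightarrow> w i \<le> n i" "\<And>i. i < t \<Longrightarrow> w' i \<le> n i"
    and q: "\<And>i. i < t \<Longrightarrow> 0 < n i \<Longrightarrow> 0 < q i" and i: "i < t"
  shows "w i = w' i"
\<comment> \<open>Without components at \<open>i\<close> there is no control over
  \<open>q i\<close>, but then both weights are 0.\<close>
proof (cases "n i = 0")
  case True
  then show ?thesis using w[OF i] by simp
next
  case False
  have "coeff (krawtchouk (q i) (n i) (w i)) k = coeff (krawtchouk (q i) (n i) (w' i)) k" for k
  proof (cases "k \<le> n i")
    case True
    let ?m = "\<lambda>l\<in>{..<t}. if l = i then k else 0"
    have m: "?m \<in> idx_set t n" using True by (auto simp: idx_set_def)
    have "(\<Prod>l<t. coeff (krawtchouk (q l) (n l) (v l)) (?m l)) = coeff (krawtchouk (q i) (n i) (v i)) k" for v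
    proof -
      have "(\<Prod>l<t. coeff (krawtchouk (q l) (n l) (v l)) (?m l)) =
          (\<Prod>l<t. if l = i then coeff (krawtchouk (q i) (n i) (v i)) k else 1)"
        by (intro prod.cong) (auto simp: coeff_0_krawtchouk)
      then show ?thesis using i by simp
    qed
    then show ?thesis using eq[OF m] by simp
  next
    case False
    then show ?thesis
      using degree_krawtchouk[OF w(1)[OF i], of "q i"] degree_krawtchouk[OF w(2)[OF i], of "q i"]
      by (simp add: coeff_eq_0)
  qed
  then have "krawtchouk (q i) (n i) (w i) = krawtchouk (q i) (n i) (w' i)" by (rule poly_eqI)
  then show ?thesis using krawtchouk_inj[OF q[OF i] w(1)[OF i] w(2)[OF i]] False by simp
qed

section \<open>Doubly indexed products\<close>

text \<open>Carrier, radical and socle of the standard ring all have this shape, so membership and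
  sums are treated once for all three.\<close>

definition box :: "nat \<Rightarrow> (nat \<Rightarrow> nat) \<Rightarrow> (nat \<Rightarrow> nat \<Rightarrow> 'a set) \<Rightarrow> (nat \<Rightarrow> nat \<Rightarrow> 'a) set" where
  "box t n B = (\<Pi>\<^sub>E i\<in>{..<t}. \<Pi>\<^sub>E j\<in>{..<n i}. B i j)"

definition box_fun :: "nat \<Rightarrow> (nat \<Rightarrow> nat) \<Rightarrow> (nat \<Rightarrow> nat \<Rightarrow> 'a) \<Rightarrow> nat \<Rightarrow> nat \<Rightarrow> 'a" where
  "box_fun t n f = (\<lambda>i\<in>{..<t}. \<lambda>j\<in>{..<n i}. f i j)"

lemma box_fun_apply [simp]: "i < t \<Longrightarrow> j < n i \<Longrightarrow> box_fun t n f i j = f i j"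
  by (simp add: box_fun_def)

lemma box_fun_mem: "(\<And>i j. i < t \<Longrightarrow> j < n i \<Longrightarrow> f i j \<in> B i j) \<Longrightarrow> box_fun t n f \<in> box t n B"
  by (auto simp: box_def box_fun_def)

lemma box_mem: "a \<in> box t n B \<Longrightarrow> i < t \<Longrightarrow> j < n i \<Longrightarrow> a i j \<in> B i j"
  by (auto simp: box_def dest!: PiE_mem)

lemma box_ext:
  assumes a: "a \<in> box t n B" and b: "b \<in> box t n B'"
    and eq: "\<And>i j. i < t \<Longrightarrow> j < n i \<Longrightarrow> a i j = b i j"
  shows "a = b"
proof (rule extensionalityI[of _ "{..<t}"])
  show "a \<in> extensional {..<t}" "b \<in> extensional {..<t}"
    using a b by (auto simp: box_def PiE_def)
  fix i assume i: "i \<in> {..<t}"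
  then have "a i \<in> extensional {..<n i}" "b i \<in> extensional {..<n i}"
    using a b by (auto simp: box_def PiE_def Pi_def)
  then show "a i = b i" using eq i by (intro extensionalityI[of _ "{..<n i}"]) auto
qed

lemma box_eq_box_fun: "a \<in> box t n B \<Longrightarrow> a = box_fun t n a"
  by (rule box_ext[of a t n B _ "\<lambda>_ _. UNIV"]) (auto intro: box_fun_mem)

lemma box_memI:
  assumes "a \<in> box t n B" "\<And>i j. i < t \<Longrightarrow> j < n i \<Longrightarrow> a i j \<in> B' i j"
  shows "a \<in> box t n B'"
  using box_eq_box_fun[OF assms(1)] box_fun_mem[of t n a B'] assms(2) by simp

lemma finite_box: "(\<And>i j. i < t \<Longrightarrow> j < n i \<Longrightarrow> finite (B i j)) \<Longrightarrow> finite (box t n B)"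
  unfolding box_def by (auto intro!: finite_PiE)

lemma PiE_Collect_eq: "{b \<in> PiE I B. \<forall>i\<in>I. P i (b i)} = (\<Pi>\<^sub>E i\<in>I. {x \<in> B i. P i x})"
  by (auto simp: PiE_def Pi_def)

lemma sum_box:
  fixes F :: "nat \<Rightarrow> nat \<Rightarrow> 'a \<Rightarrow> complex"
  assumes "\<And>i j. i < t \<Longrightarrow> j < n i \<Longrightarrow> finite (B i j)"
  shows "(\<Sum>b\<in>box t n B. \<Prod>i<t. \<Prod>j<n i. F i j (b i j)) = (\<Prod>i<t. \<Prod>j<n i. \<Sum>y\<in>B i j. F i j y)"
proof -
  have "(\<Prod>i<t. \<Prod>j<n i. \<Sum>y\<in>B i j. F i j y) =
      (\<Prod>i<t. \<Sum>x\<in>(\<Pi>\<^sub>E j\<in>{..<n i}. B i j). \<Prod>j<n i. F i j (x j))"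
    using assms by (intro prod.cong prod_sum_PiE) auto
  also have "\<dots> = (\<Sum>b\<in>box t n B. \<Prod>i<t. \<Prod>j<n i. F i j (b i j))"
    unfolding box_def using assms by (intro prod_sum_PiE finite_PiE) auto
  finally show ?thesis by simp
qed

text \<open>The weight conditions for different \<open>i\<close> are independent, so the summation
  set is itself a product and the sum factors over \<open>i\<close>; each factor is one coefficient
  of a generating function.\<close>

lemma sum_box_weight:
  fixes F :: "nat \<Rightarrow> nat \<Rightarrow> 'a \<Rightarrow> complex"
  assumes "\<And>i j. i < t \<Longrightarrow> j < n i \<Longrightarrow> finite (B i j)"
  shows "(\<Sum>b\<in>{b \<in> box t n B. \<forall>i<t. card {j. j < n i \<and> P i j (b i j)} = m i}.
      \<Prod>i<t. \<Prod>j<n i. F i j (b i j)) =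
    (\<Prod>i<t. coeff (\<Prod>j<n i. [:\<Sum>y\<in>{y \<in> B i j. \<not> P i j y}. F i j y, \<Sum>y\<in>{y \<in> B i j. P i j y}. F i j y:]) (m i))"
proof -
  let ?D = "\<lambda>i. {x \<in> (\<Pi>\<^sub>E j\<in>{..<n i}. B i j). card {j. j < n i \<and> P i j (x j)} = m i}"
  have fin: "finite (?D i)" if "i < t" for i
  proof (rule finite_subset)
    show "?D i \<subseteq> (\<Pi>\<^sub>E j\<in>{..<n i}. B i j)" by blast
    show "finite (\<Pi>\<^sub>E j\<in>{..<n i}. B i j)" using assms that by (intro finite_PiE) auto
  qed
  have "{b \<in> box t n B. \<forall>i<t. card {j. j < n i \<and> P i j (b i j)} = m i} = (\<Pi>\<^sub>E i\<in>{..<t}. ?D i)"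
    using PiE_Collect_eq[of "{..<t}" "\<lambda>i. \<Pi>\<^sub>E j\<in>{..<n i}. B i j" "\<lambda>i x. card {j. j < n i \<and> P i j (x j)} = m i"]
    by (simp add: box_def lessThan_iff Ball_def)
  then have "(\<Sum>b\<in>{b \<in> box t n B. \<forall>i<t. card {j. j < n i \<and> P i j (b i j)} = m i}.
      \<Prod>i<t. \<Prod>j<n i. F i j (b i j)) = (\<Sum>b\<in>(\<Pi>\<^sub>E i\<in>{..<t}. ?D i). \<Prod>i<t. \<Prod>j<n i. F i j (b i j))"
    by simp
  also have "\<dots> = (\<Prod>i<t. \<Sum>x\<in>?D i. \<Prod>j<n i. F i j (x j))"
    using fin by (intro prod_sum_PiE[symmetric]) auto
  also have "\<dots> = (\<Prod>i<t. coeff (\<Prod>j<n i. [:\<Sum>y\<in>{y \<in> B i j. \<not> P i j y}. F i j y, \<Sum>y\<in>{y \<in> B i j. P i j y}. F i j y:]) (m i))"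
    using assms by (intro prod.cong coeff_prod_sum_weight) auto
  finally show ?thesis .
qed

lemma card_bounded_eq_0_iff: "card {j. j < (N::nat) \<and> P j} = 0 \<longleftrightarrow> (\<forall>j<N. \<not> P j)"
  by (auto simp: card_eq_0_iff)

lemma card_bounded_le: "card {j. j < (N::nat) \<and> P j} \<le> N"
  using card_mono[of "{..<N}" "{j. j < N \<and> P j}"] by auto

text \<open>Classes in a quotient are never empty here, whereas a list of described blocks may
  contain empty sets; hence the filter on the right-hand side, which matches the definitions of both
  partitions.\<close>

lemma quotient_eq_nonempty_blocks:
  assumes cover: "\<And>a. a \<in> C \<Longrightarrow> \<exists>B\<in>\<B>. a \<in> B"
    and blocks: "\<And>B a. B \<in> \<B> \<Longrightarrow> a \<in> B \<Longrightarrow> a \<in> C \<and> r `` {a} = B"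
  shows "C // r = {B \<in> \<B>. B \<noteq> {}}"
proof (intro equalityI subsetI)
  fix X assume "X \<in> C // r"
  then obtain a where a: "a \<in> C" "X = r `` {a}" by (auto elim: quotientE)
  then obtain B where B: "B \<in> \<B>" "a \<in> B" using cover by blast
  then have "X = B" using blocks a by blast
  then show "X \<in> {B \<in> \<B>. B \<noteq> {}}" using B by auto
next
  fix B assume "B \<in> {B \<in> \<B>. B \<noteq> {}}"
  then obtain a where "B \<in> \<B>" "a \<in> B" by auto
  then have "a \<in> C" "r `` {a} = B" using blocks by blast+
  then show "B \<in> C // r" using quotientI[of a C r] by simp
qed

text \<open>Used with \<open>E\<close> saying that two sums over a block agree. Sums over the empty
  set agree, so discarding empty blocks loses no condition.\<close>

lemma ball_nonempty_blocks:
  assumes "E {}"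
  shows "(\<forall>P\<in>{B \<in> insert D (F ` I). B \<noteq> {}}. E P) \<longleftrightarrow> E D \<and> (\<forall>m\<in>I. E (F m))"
proof -
  have "(\<forall>P\<in>{B \<in> \<B>. B \<noteq> {}}. E P) \<longleftrightarrow> (\<forall>P\<in>\<B>. E P)" for \<B>
  proof (intro iffI ballI)
    fix P assume "\<forall>P\<in>{B \<in> \<B>. B \<noteq> {}}. E P" "P \<in> \<B>"
    then show "E P" using assms by (cases "P = {}") auto
  qed simp
  from this[of "insert D (F ` I)"] show ?thesis by (simp only: ball_simps)
qed

section \<open>Rings in standard form\<close>

locale standard_form =
  fixes t :: nat and n :: "nat \<Rightarrow> nat" and q :: "nat \<Rightarrow> nat" and Rc :: "nat \<Rightarrow> nat \<Rightarrow> 'a ring"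
  assumes comp: "\<And>i j. i < t \<Longrightarrow> j < n i \<Longrightarrow> finite_local_frobenius (Rc i j)"
    and res_card: "\<And>i j. i < t \<Longrightarrow> j < n i \<Longrightarrow>
                     card (carrier (Rc i j Quot jacobson_rad (Rc i j))) = q i"
    and soc_card: "\<And>i j. i < t \<Longrightarrow> j < n i \<Longrightarrow> card (socle (Rc i j)) = q i"
begin

abbreviation R where "R \<equiv> std_ring t n Rc"
abbreviation wtv where "wtv a i \<equiv> hwt (n i) (Rc i) (a i)"
abbreviation wtv_rad where "wtv_rad a i \<equiv> hwt_rad (n i) (Rc i) (a i)"

lemma component: "i < t \<Longrightarrow> j < n i \<Longrightarrow> finite_local_ring_q (Rc i j) (q i)"
  using comp[of i j] res_card[of i j] soc_card[of i j]
  by (simp add: finite_local_frobenius_def local_ring_def finite_local_ring_q_def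
      finite_local_ring_def finite_local_ring_axioms_def finite_local_ring_q_axioms_def)

lemma component_local: "i < t \<Longrightarrow> j < n i \<Longrightarrow> finite_local_ring (Rc i j)"
  using component by (simp add: finite_local_ring_q_def)

lemma component_ring: "i < t \<Longrightarrow> j < n i \<Longrightarrow> ring (Rc i j)"
  using component_local by (simp add: finite_local_ring_def)

lemma carrier_R: "carrier R = box t n (\<lambda>i j. carrier (Rc i j))"
  by (simp add: std_ring_def comp_carrier_def box_def)

lemma std_rad_box: "std_rad t n Rc = box t n (\<lambda>i j. jacobson_rad (Rc i j))"
  by (simp add: std_rad_def box_def)

lemma std_soc_box: "std_soc t n Rc = box t n (\<lambda>i j. socle (Rc i j))"
  by (simp add: std_soc_def box_def)

lemma mult_R: "a \<otimes>\<^bsub>R\<^esub> b = box_fun t n (\<lambda>i j. a i j \<otimes>\<^bsub>Rc i j\<^esub> b i j)"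
  by (simp add: std_ring_def box_fun_def)

lemma add_R: "a \<oplus>\<^bsub>R\<^esub> b = box_fun t n (\<lambda>i j. a i j \<oplus>\<^bsub>Rc i j\<^esub> b i j)"
  by (simp add: std_ring_def box_fun_def)

lemma zero_R: "\<zero>\<^bsub>R\<^esub> = box_fun t n (\<lambda>i j. \<zero>\<^bsub>Rc i j\<^esub>)"
  by (simp add: std_ring_def box_fun_def)

lemma zero_mem: "\<zero>\<^bsub>R\<^esub> \<in> carrier R"
  unfolding zero_R carrier_R
  by (intro box_fun_mem) (simp add: component_ring ring.ring_simprules)

lemma mult_mem:
  assumes "a \<in> carrier R" "b \<in> carrier R"
  shows "a \<otimes>\<^bsub>R\<^esub> b \<in> carrier R"
  unfolding mult_R carrier_R
proof (rule box_fun_mem)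
  fix i j assume ij: "i < t" "j < n i"
  then show "a i j \<otimes>\<^bsub>Rc i j\<^esub> b i j \<in> carrier (Rc i j)"
    using assms[unfolded carrier_R, THEN box_mem, OF ij] component_ring[OF ij]
    by (simp add: ring.ring_simprules)
qed

lemma add_mem:
  assumes "a \<in> carrier R" "b \<in> carrier R"
  shows "a \<oplus>\<^bsub>R\<^esub> b \<in> carrier R"
  unfolding add_R carrier_R
proof (rule box_fun_mem)
  fix i j assume ij: "i < t" "j < n i"
  then show "a i j \<oplus>\<^bsub>Rc i j\<^esub> b i j \<in> carrier (Rc i j)"
    using assms[unfolded carrier_R, THEN box_mem, OF ij] component_ring[OF ij]
    by (simp add: ring.ring_simprules)
qed

lemma soc_subset: "std_soc t n Rc \<subseteq> carrier R"
proof
  fix a assume a: "a \<in> std_soc t n Rc"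
  show "a \<in> carrier R"
    unfolding carrier_R using a[unfolded std_soc_box]
  proof (rule box_memI)
    fix i j assume ij: "i < t" "j < n i"
    show "a i j \<in> carrier (Rc i j)"
      using finite_local_ring.L_carrier[OF component_local[OF ij]] box_mem[OF a[unfolded std_soc_box] ij] .
  qed
qed

lemma rad_subset: "std_rad t n Rc \<subseteq> carrier R"
proof
  fix a assume a: "a \<in> std_rad t n Rc"
  show "a \<in> carrier R"
    unfolding carrier_R using a[unfolded std_rad_box]
  proof (rule box_memI)
    fix i j assume ij: "i < t" "j < n i"
    show "a i j \<in> carrier (Rc i j)"
      using finite_local_ring.J_carrier[OF component_local[OF ij]] box_mem[OF a[unfolded std_rad_box] ij] .
  qed
qed

lemma finite_R: "finite (carrier R)"
  unfolding carrier_R by (intro finite_box) (simp add: component_local finite_local_ring.finite_carrier)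

lemma eq_zero_iff: "a \<in> carrier R \<Longrightarrow> a = \<zero>\<^bsub>R\<^esub> \<longleftrightarrow> (\<forall>i<t. \<forall>j<n i. a i j = \<zero>\<^bsub>Rc i j\<^esub>)"
proof
  assume a: "a \<in> carrier R" "\<forall>i<t. \<forall>j<n i. a i j = \<zero>\<^bsub>Rc i j\<^esub>"
  then show "a = \<zero>\<^bsub>R\<^esub>"
    using zero_mem unfolding carrier_R by (intro box_ext) (auto simp: zero_R)
qed (simp add: zero_R)

lemma in_soc_iff: "a \<in> carrier R \<Longrightarrow> a \<in> std_soc t n Rc \<longleftrightarrow> (\<forall>i<t. \<forall>j<n i. a i j \<in> socle (Rc i j))"
  unfolding std_soc_box carrier_R by (auto intro: box_memI dest: box_mem)

lemma in_rad_iff: "a \<in> carrier R \<Longrightarrow> a \<in> std_rad t n Rc \<longleftrightarrow> (\<forall>i<t. \<forall>j<n i. a i j \<in> jacobson_rad (Rc i j))"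
  unfolding std_rad_box carrier_R by (auto intro: box_memI dest: box_mem)

lemma zero_in_rad: "\<zero>\<^bsub>R\<^esub> \<in> std_rad t n Rc"
  using in_rad_iff[OF zero_mem] by (simp add: zero_R component_local finite_local_ring.zero_J)

lemma eq_zero_iff_wtv: "a \<in> carrier R \<Longrightarrow> a = \<zero>\<^bsub>R\<^esub> \<longleftrightarrow> (\<forall>i<t. wtv a i = 0)"
  by (simp add: eq_zero_iff hwt_def card_bounded_eq_0_iff)

lemma in_rad_iff_wtv: "a \<in> carrier R \<Longrightarrow> a \<in> std_rad t n Rc \<longleftrightarrow> (\<forall>i<t. wtv_rad a i = 0)"
  by (simp add: in_rad_iff hwt_rad_def card_bounded_eq_0_iff)

section \<open>Weight vectors and the equivalence relations behind both partitions\<close>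

lemma restrict_wtv_idx: "restrict (wtv a) {..<t} \<in> idx_set t n"
  and restrict_wtv_rad_idx: "restrict (wtv_rad a) {..<t} \<in> idx_set t n"
  by (auto simp: idx_set_def hwt_def hwt_rad_def card_bounded_le)

lemma idx_ext: "m \<in> idx_set t n \<Longrightarrow> m' \<in> idx_set t n \<Longrightarrow> (\<And>i. i < t \<Longrightarrow> m i = m' i) \<Longrightarrow> m = m'"
  unfolding idx_set_def by (rule PiE_ext) auto

lemma idx_zero_mem: "idx_zero t \<in> idx_set t n"
  by (auto simp: idx_zero_def idx_set_def)

text \<open>Equal weights modulo the radical already separate all \<open>Q_block\<close> sets with
  nonzero index. The weight vector 0 describes the whole radical, and the last condition splits it
  into zero and the rest.\<close>

definition Q_rel :: "((nat \<Rightarrow> nat \<Rightarrow> 'a) \<times> (nat \<Rightarrow> nat \<Rightarrow> 'a)) set" where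
  "Q_rel = {(a, a'). a \<in> carrier R \<and> a' \<in> carrier R \<and>
     (\<forall>i<t. wtv_rad a i = wtv_rad a' i) \<and> (a = \<zero>\<^bsub>R\<^esub> \<longleftrightarrow> a' = \<zero>\<^bsub>R\<^esub>)}"

definition H_rel :: "((nat \<Rightarrow> nat \<Rightarrow> 'a) \<times> (nat \<Rightarrow> nat \<Rightarrow> 'a)) set" where
  "H_rel = {(a, a'). a \<in> carrier R \<and> a' \<in> carrier R \<and>
     (a \<in> std_soc t n Rc \<longleftrightarrow> a' \<in> std_soc t n Rc) \<and>
     (a \<in> std_soc t n Rc \<longrightarrow> (\<forall>i<t. wtv a i = wtv a' i))}"

lemma H_quotient: "carrier R // H_rel = H_partition t n Rc"
  unfolding H_partition_def
proof (rule quotient_eq_nonempty_blocks)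
  fix a assume a: "a \<in> carrier R"
  show "\<exists>B\<in>insert (H_diamond t n Rc) (H_block t n Rc ` idx_set t n). a \<in> B"
  proof (cases "a \<in> std_soc t n Rc")
    case True
    then have "a \<in> H_block t n Rc (restrict (wtv a) {..<t})" by (simp add: H_block_def)
    then show ?thesis using restrict_wtv_idx by blast
  qed (use a in \<open>auto simp: H_diamond_def\<close>)
next
  fix B a assume B: "B \<in> insert (H_diamond t n Rc) (H_block t n Rc ` idx_set t n)" and a: "a \<in> B"
  from B consider "B = H_diamond t n Rc" | m where "m \<in> idx_set t n" "B = H_block t n Rc m" by auto
  then show "a \<in> carrier R \<and> H_rel `` {a} = B"
  proof cases
    case 1
    then show ?thesis using a by (auto simp: H_diamond_def H_rel_def)
  next
    case 2
    then show ?thesis using a soc_subset by (auto simp: H_block_def H_rel_def)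
  qed
qed

text \<open>A nonzero index forces some weight modulo the radical to be positive, so removing the
  radical in \<open>Q_block\<close> is automatic.\<close>

lemma Q_block_nonzero:
  assumes "m \<in> idx_set t n" "m \<noteq> idx_zero t"
  shows "Q_block t n Rc m = {a \<in> carrier R. \<forall>i<t. wtv_rad a i = m i}"
proof -
  have "\<exists>i<t. m i \<noteq> 0"
    using idx_ext[OF assms(1) idx_zero_mem] assms(2) by (auto simp: idx_zero_def)
  then show ?thesis using assms(2) by (auto simp: Q_block_def in_rad_iff_wtv)
qed

lemma Q_quotient: "carrier R // Q_rel = Q_partition t n Rc"
  unfolding Q_partition_def
proof (rule quotient_eq_nonempty_blocks)
  fix a assume a: "a \<in> carrier R"
  show "\<exists>B\<in>insert (Q_diamond t n Rc) (Q_block t n Rc ` idx_set t n). a \<in> B"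
  proof (cases "a \<in> std_rad t n Rc")
    case True
    show ?thesis
    proof (cases "a = \<zero>\<^bsub>R\<^esub>")
      case True
      then have "a \<in> Q_block t n Rc (idx_zero t)" by (simp add: Q_block_def)
      then show ?thesis using idx_zero_mem by blast
    qed (use True in \<open>auto simp: Q_diamond_def\<close>)
  next
    case False
    let ?m = "restrict (wtv_rad a) {..<t}"
    obtain i where "i < t" "wtv_rad a i \<noteq> 0" using False in_rad_iff_wtv[OF a] by blast
    then have "?m i \<noteq> idx_zero t i" by (simp add: idx_zero_def)
    then have "?m \<noteq> idx_zero t" by metis
    then have "a \<in> Q_block t n Rc ?m"
      using Q_block_nonzero[OF restrict_wtv_rad_idx] a by simp
    then show ?thesis using restrict_wtv_rad_idx by blast
  qed
next
  fix B a assume B: "B \<in> insert (Q_diamond t n Rc) (Q_block t n Rc ` idx_set t n)" and a: "a \<in> B"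
  from B consider "B = Q_diamond t n Rc" | "B = Q_block t n Rc (idx_zero t)"
    | m where "m \<in> idx_set t n" "m \<noteq> idx_zero t" "B = Q_block t n Rc m" by auto
  then show "a \<in> carrier R \<and> Q_rel `` {a} = B"
  proof cases
    case 1
    have "b \<in> std_rad t n Rc \<longleftrightarrow> b \<in> carrier R \<and> (\<forall>i<t. wtv_rad b i = 0)" for b
      using rad_subset in_rad_iff_wtv by blast
    with 1 show ?thesis using a by (auto simp: Q_diamond_def Q_rel_def)
  next
    case 2
    have "wtv_rad \<zero>\<^bsub>R\<^esub> i = 0" if "i < t" for i
      using in_rad_iff_wtv[OF zero_mem] zero_in_rad that by blast
    with 2 show ?thesis using a zero_mem by (auto simp: Q_block_def Q_rel_def)
  next
    case 3
    obtain i where i: "i < t" "m i \<noteq> 0"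
      using idx_ext[OF 3(1) idx_zero_mem] 3(2) by (auto simp: idx_zero_def)
    have "wtv_rad \<zero>\<^bsub>R\<^esub> i = 0"
      using in_rad_iff_wtv[OF zero_mem] zero_in_rad i by blast
    then show ?thesis using 3 a i by (auto simp: Q_block_nonzero Q_rel_def)
  qed
qed

section \<open>Number of blocks, and the case where the ring equals its socle\<close>

lemma socle_nonzero:
  assumes "i < t" "j < n i"
  shows "\<exists>x. x \<in> socle (Rc i j) \<and> x \<noteq> \<zero>\<^bsub>Rc i j\<^esub>"
  using finite_local_ring_q.socle_cyclic[OF component[OF assms]] by metis

text \<open>The witness has a nonzero socle element in the first \<open>m i\<close> positions of
  each \<open>i\<close> and zeros after that. This keeps every block nonempty and gives the exact
  block count.\<close>

lemma soc_weight_exists: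
  assumes m: "\<And>i. i < t \<Longrightarrow> m i \<le> n i"
  shows "\<exists>a \<in> std_soc t n Rc. \<forall>i<t. wtv a i = m i"
proof -
  obtain x where x: "\<And>i j. i < t \<Longrightarrow> j < n i \<Longrightarrow> x i j \<in> socle (Rc i j) \<and> x i j \<noteq> \<zero>\<^bsub>Rc i j\<^esub>"
    using socle_nonzero by metis
  define a where "a = box_fun t n (\<lambda>i j. if j < m i then x i j else \<zero>\<^bsub>Rc i j\<^esub>)"
  have "a \<in> std_soc t n Rc"
    unfolding a_def std_soc_box
    using x by (intro box_fun_mem) (auto simp: component_local finite_local_ring.zero_L)
  moreover have "wtv a i = m i" if i: "i < t" for i
  proof -
    have "{j. j < n i \<and> a i j \<noteq> \<zero>\<^bsub>Rc i j\<^esub>} = {..<m i}"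
      using x[OF i] m[OF i] i by (auto simp: a_def split: if_splits)
    then show ?thesis by (simp add: hwt_def)
  qed
  ultimately show ?thesis by blast
qed

lemma H_block_nonempty: "m \<in> idx_set t n \<Longrightarrow> H_block t n Rc m \<noteq> {}"
  using soc_weight_exists[of m] by (auto simp: H_block_def idx_set_def PiE_iff)

lemma inj_on_H_block: "inj_on (H_block t n Rc) (idx_set t n)"
proof (rule inj_onI)
  fix m m' assume m: "m \<in> idx_set t n" "m' \<in> idx_set t n" and eq: "H_block t n Rc m = H_block t n Rc m'"
  obtain a where "a \<in> H_block t n Rc m" using H_block_nonempty[OF m(1)] by blast
  moreover from this have "a \<in> H_block t n Rc m'" using eq by simp
  ultimately show "m = m'" by (intro idx_ext[OF m]) (auto simp: H_block_def)
qed

lemma card_H_blocks: "card (H_block t n Rc ` idx_set t n) = (\<Prod>i<t. n i + 1)"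
  using card_image[OF inj_on_H_block] by (simp add: idx_set_def card_PiE)

lemma H_partition_if_soc:
  "carrier R = std_soc t n Rc \<Longrightarrow> H_partition t n Rc = H_block t n Rc ` idx_set t n"
  using H_block_nonempty by (auto simp: H_partition_def H_diamond_def)

lemma card_H_partition_if_not_soc:
  assumes "carrier R \<noteq> std_soc t n Rc"
  shows "card (H_partition t n Rc) = (\<Prod>i<t. n i + 1) + 1"
proof -
  have ne: "H_diamond t n Rc \<noteq> {}" using assms soc_subset by (auto simp: H_diamond_def)
  have "H_partition t n Rc = insert (H_diamond t n Rc) (H_block t n Rc ` idx_set t n)"
    using H_block_nonempty ne by (auto simp: H_partition_def)
  moreover have "H_diamond t n Rc \<notin> H_block t n Rc ` idx_set t n"
    using ne by (auto simp: H_diamond_def H_block_def)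
  moreover have "finite (H_block t n Rc ` idx_set t n)"
    by (auto simp: idx_set_def intro!: finite_PiE)
  ultimately show ?thesis using card_H_blocks by simp
qed

lemma H_partition_product:
  assumes eq: "carrier R = std_soc t n Rc"
  shows "H_partition t n Rc = product_partition t (\<lambda>i. hamming_partition (n i) (Rc i))"
proof -
  define D where "D = (\<lambda>i k. {x \<in> (\<Pi>\<^sub>E j\<in>{..<n i}. carrier (Rc i j)). hwt (n i) (Rc i) x = k})"
  have block: "H_block t n Rc m = (\<Pi>\<^sub>E i\<in>{..<t}. D i (m i))" for m
    unfolding H_block_def eq[symmetric] D_def
    using PiE_Collect_eq[of "{..<t}" "\<lambda>i. \<Pi>\<^sub>E j\<in>{..<n i}. carrier (Rc i j)" "\<lambda>i x. hwt (n i) (Rc i) x = m i"]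
    by (simp add: std_ring_def comp_carrier_def Ball_def)
  \<comment> \<open>\<open>hamming_partition\<close> discards empty sets, so its blocks must be
    shown nonempty. A factor of a nonempty product is nonempty, which reduces this to the blocks of
    \<open>H_partition\<close>.\<close>
  have ne: "D i k \<noteq> {}" if "i < t" "k \<le> n i" for i k
  proof -
    let ?m = "\<lambda>l\<in>{..<t}. if l = i then k else 0"
    have "?m \<in> idx_set t n" using that by (auto simp: idx_set_def)
    then have "(\<Pi>\<^sub>E l\<in>{..<t}. D l (?m l)) \<noteq> {}" using H_block_nonempty block by metis
    then have "D i (?m i) \<noteq> {}" using that unfolding PiE_eq_empty_iff by blast
    then show ?thesis using that by simp
  qed
  have hamming: "hamming_partition (n i) (Rc i) = D i ` {0..n i}" if "i < t" for i
  proof -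
    have "hamming_partition (n i) (Rc i) = {B \<in> D i ` {0..n i}. B \<noteq> {}}"
      by (simp add: hamming_partition_def D_def)
    then show ?thesis using ne[OF that] by auto
  qed
  have "product_partition t (\<lambda>i. hamming_partition (n i) (Rc i)) =
      (\<lambda>B. \<Pi>\<^sub>E i\<in>{..<t}. B i) ` (\<Pi>\<^sub>E i\<in>{..<t}. D i ` {0..n i})"
    unfolding product_partition_def using hamming by (intro arg_cong[where f = "image _"] PiE_cong) auto
  also have "\<dots> = H_block t n Rc ` idx_set t n"
  proof (intro equalityI subsetI)
    fix X assume "X \<in> (\<lambda>B. \<Pi>\<^sub>E i\<in>{..<t}. B i) ` (\<Pi>\<^sub>E i\<in>{..<t}. D i ` {0..n i})"
    then obtain B where B: "B \<in> (\<Pi>\<^sub>E i\<in>{..<t}. D i ` {0..n i})" "X = (\<Pi>\<^sub>E i\<in>{..<t}. B i)" by auto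
    have "\<forall>i. \<exists>k. i < t \<longrightarrow> k \<le> n i \<and> B i = D i k"
    proof
      fix i show "\<exists>k. i < t \<longrightarrow> k \<le> n i \<and> B i = D i k"
        using PiE_mem[OF B(1), of i] unfolding image_iff Bex_def atLeastAtMost_iff lessThan_iff by blast
    qed
    then obtain k where k: "\<And>i. i < t \<Longrightarrow> k i \<le> n i \<and> B i = D i (k i)" by metis
    have "restrict k {..<t} \<in> idx_set t n" using k by (auto simp: idx_set_def)
    moreover have "X = H_block t n Rc (restrict k {..<t})"
      unfolding block B(2) using k by (intro PiE_cong) auto
    ultimately show "X \<in> H_block t n Rc ` idx_set t n" by blast
  next
    fix X assume "X \<in> H_block t n Rc ` idx_set t n"
    then obtain m where m: "m \<in> idx_set t n" "X = (\<Pi>\<^sub>E i\<in>{..<t}. D i (m i))" using block by auto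
    let ?B = "\<lambda>i\<in>{..<t}. D i (m i)"
    have "?B \<in> (\<Pi>\<^sub>E i\<in>{..<t}. D i ` {0..n i})" using m(1) by (auto simp: idx_set_def PiE_iff)
    moreover have "X = (\<Pi>\<^sub>E i\<in>{..<t}. ?B i)" unfolding m(2) by (intro PiE_cong) auto
    ultimately show "X \<in> (\<lambda>B. \<Pi>\<^sub>E i\<in>{..<t}. B i) ` (\<Pi>\<^sub>E i\<in>{..<t}. D i ` {0..n i})" by blast
  qed
  finally show ?thesis using H_partition_if_soc[OF eq] by simp
qed

text \<open>Each component now has \<open>\<one>\<close> in its socle, which the radical
  annihilates; so all radicals vanish, weights modulo the radical become Hamming weights, and the
  two relations coincide.\<close>

lemma Q_partition_if_soc:
  assumes eq: "carrier R = std_soc t n Rc"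
  shows "Q_partition t n Rc = H_partition t n Rc"
proof -
  have J: "x \<in> jacobson_rad (Rc i j) \<longleftrightarrow> x = \<zero>\<^bsub>Rc i j\<^esub>" if ij: "i < t" "j < n i" for i j x
  proof -
    interpret A: finite_local_ring_q "Rc i j" "q i" using component[OF ij] .
    have "box_fun t n (\<lambda>i j. \<one>\<^bsub>Rc i j\<^esub>) \<in> carrier R"
      unfolding carrier_R by (intro box_fun_mem) (simp add: component_ring ring.ring_simprules)
    then have "\<one>\<^bsub>Rc i j\<^esub> \<in> A.L" using ij unfolding eq std_soc_box by (auto dest: box_mem[of _ t n _ i j])
    then have "x \<otimes>\<^bsub>Rc i j\<^esub> \<one>\<^bsub>Rc i j\<^esub> = \<zero>\<^bsub>Rc i j\<^esub>" if "x \<in> A.J" using A.J_socle_zero that by blast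
    then show ?thesis using A.J_carrier A.zero_J by auto
  qed
  have "wtv_rad a i = wtv a i" if "i < t" for a i
    using J[OF that] by (auto simp: hwt_def hwt_rad_def intro!: arg_cong[where f = card])
  moreover have "a = \<zero>\<^bsub>R\<^esub> \<longleftrightarrow> a' = \<zero>\<^bsub>R\<^esub>"
    if "a \<in> carrier R" "a' \<in> carrier R" "\<forall>i<t. wtv a i = wtv a' i" for a a'
    using that by (simp add: eq_zero_iff_wtv)
  ultimately have "Q_rel = H_rel"
    unfolding Q_rel_def H_rel_def eq[symmetric] by auto
  then show ?thesis using H_quotient Q_quotient by simp
qed

end

section \<open>Dual partitions\<close>

locale standard_form_char = standard_form t n q Rc
  for t n q and Rc :: "nat \<Rightarrow> nat \<Rightarrow> 'a ring" +
  fixes \<chi> :: "(nat \<Rightarrow> nat \<Rightarrow> 'a) \<Rightarrow> complex"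
  assumes gen: "generating_character (std_ring t n Rc) \<chi>"
begin

section \<open>Splitting the character into component characters\<close>

definition emb :: "nat \<Rightarrow> nat \<Rightarrow> 'a \<Rightarrow> nat \<Rightarrow> nat \<Rightarrow> 'a" where
  "emb i j x = box_fun t n (\<lambda>k l. if k = i \<and> l = j then x else \<zero>\<^bsub>Rc k l\<^esub>)"

lemma chi_zero: "\<chi> \<zero>\<^bsub>R\<^esub> = 1"
  and chi_add: "a \<in> carrier R \<Longrightarrow> b \<in> carrier R \<Longrightarrow> \<chi> (a \<oplus>\<^bsub>R\<^esub> b) = \<chi> a * \<chi> b"
  using gen by (auto simp: generating_character_def additive_character_def)

lemma box_fun_in_R: "(\<And>i j. i < t \<Longrightarrow> j < n i \<Longrightarrow> f i j \<in> carrier (Rc i j)) \<Longrightarrow> box_fun t n f \<in> carrier R"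
  unfolding carrier_R by (rule box_fun_mem)

lemma R_eqI:
  "a \<in> carrier R \<Longrightarrow> b \<in> carrier R \<Longrightarrow> (\<And>i j. i < t \<Longrightarrow> j < n i \<Longrightarrow> a i j = b i j) \<Longrightarrow> a = b"
  unfolding carrier_R by (rule box_ext)

lemma R_mem: "a \<in> carrier R \<Longrightarrow> i < t \<Longrightarrow> j < n i \<Longrightarrow> a i j \<in> carrier (Rc i j)"
  unfolding carrier_R by (rule box_mem)

lemma comp_zero: "i < t \<Longrightarrow> j < n i \<Longrightarrow> \<zero>\<^bsub>Rc i j\<^esub> \<in> carrier (Rc i j)"
  by (simp add: component_ring ring.ring_simprules)

lemma emb_mem: "x \<in> carrier (Rc i j) \<Longrightarrow> emb i j x \<in> carrier R"
  unfolding emb_def by (rule box_fun_in_R) (auto simp: comp_zero)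

text \<open>Form of \<open>chi_prod\<close> suited to induction: enlarging the coordinate set
  \<open>S\<close> by one index adds one embedded coordinate, and \<open>\<chi>\<close> turns the
  sum into a product.\<close>

lemma chi_restrict:
  assumes "finite S" "S \<subseteq> (SIGMA i:{..<t}. {..<n i})" and a: "a \<in> carrier R"
  shows "\<chi> (box_fun t n (\<lambda>i j. if (i, j) \<in> S then a i j else \<zero>\<^bsub>Rc i j\<^esub>)) =
    (\<Prod>(i, j)\<in>S. \<chi> (emb i j (a i j)))"
  using assms(1,2)
proof (induction S rule: finite_induct)
  case empty
  then show ?case using chi_zero by (simp add: zero_R)
next
  case (insert p S)
  obtain k l where p: "p = (k, l)" by (cases p)
  have kl: "k < t" "l < n k" using insert.prems p by auto
  let ?r = "\<lambda>S. box_fun t n (\<lambda>i j. if (i, j) \<in> S then a i j else \<zero>\<^bsub>Rc i j\<^esub>)"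
  have r: "?r S \<in> carrier R" for S
    by (rule box_fun_in_R) (auto simp: comp_zero R_mem[OF a])
  have e: "emb k l (a k l) \<in> carrier R" using kl a by (intro emb_mem R_mem)
  have m: "?r S \<oplus>\<^bsub>R\<^esub> emb k l (a k l) \<in> carrier R"
    using r e by (rule add_mem)
  have "?r (insert p S) = ?r S \<oplus>\<^bsub>R\<^esub> emb k l (a k l)"
  proof (rule R_eqI[OF r m])
    fix i j assume ij: "i < t" "j < n i"
    show "?r (insert p S) i j = (?r S \<oplus>\<^bsub>R\<^esub> emb k l (a k l)) i j"
      using ij p insert.hyps R_mem[OF a ij] component_ring[OF ij]
      by (auto simp: add_R emb_def ring.ring_simprules)
  qed
  then show ?case using chi_add[OF r e] insert p by (simp add: mult.commute)
qed

lemma chi_prod: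
  assumes a: "a \<in> carrier R"
  shows "\<chi> a = (\<Prod>i<t. \<Prod>j<n i. \<chi> (emb i j (a i j)))"
proof -
  let ?S = "SIGMA i:{..<t}. {..<n i}"
  have "box_fun t n (\<lambda>i j. if (i, j) \<in> ?S then a i j else \<zero>\<^bsub>Rc i j\<^esub>) = a"
    by (rule R_eqI[OF box_fun_in_R a]) (auto simp: R_mem[OF a])
  then have "\<chi> a = (\<Prod>(i, j)\<in>?S. \<chi> (emb i j (a i j)))"
    using chi_restrict[of ?S a] a by simp
  then show ?thesis by (simp add: prod.Sigma)
qed

text \<open>Nondegeneracy descends from \<open>R\<close>: injectivity separates
  \<open>emb i j x\<close> from zero by some \<open>y\<close>, and \<open>y\<close> times
  \<open>emb i j x\<close> depends only on the coordinate \<open>y i j\<close>.\<close>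

lemma component_char:
  assumes ij: "i < t" "j < n i"
  shows "finite_local_ring_char (Rc i j) (q i) (\<lambda>x. \<chi> (emb i j x))"
proof -
  interpret A: finite_local_ring_q "Rc i j" "q i" using component[OF ij] .
  show ?thesis
  proof (unfold_locales)
    fix x y assume xy: "x \<in> carrier (Rc i j)" "y \<in> carrier (Rc i j)"
    have "emb i j (x \<oplus>\<^bsub>Rc i j\<^esub> y) = emb i j x \<oplus>\<^bsub>R\<^esub> emb i j y"
    proof (rule R_eqI)
      show "emb i j x \<oplus>\<^bsub>R\<^esub> emb i j y \<in> carrier R"
        using xy by (intro add_mem emb_mem)
      show "emb i j (x \<oplus>\<^bsub>Rc i j\<^esub> y) k l = (emb i j x \<oplus>\<^bsub>R\<^esub> emb i j y) k l" if "k < t" "l < n k" for k l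
        using that component_ring[OF that] by (auto simp: add_R emb_def ring.ring_simprules)
    qed (use xy in \<open>auto intro: emb_mem\<close>)
    then show "\<chi> (emb i j (x \<oplus>\<^bsub>Rc i j\<^esub> y)) = \<chi> (emb i j x) * \<chi> (emb i j y)"
      using chi_add emb_mem xy by simp
  next
    have "emb i j \<zero>\<^bsub>Rc i j\<^esub> = \<zero>\<^bsub>R\<^esub>"
      by (rule R_eqI[OF emb_mem zero_mem]) (auto simp: emb_def zero_R)
    then show "\<chi> (emb i j \<zero>\<^bsub>Rc i j\<^esub>) = 1" using chi_zero by simp
  next
    fix x assume x: "x \<in> carrier (Rc i j)" "x \<noteq> \<zero>\<^bsub>Rc i j\<^esub>"
    let ?f = "\<lambda>r. \<lambda>y\<in>carrier R. \<chi> (y \<otimes>\<^bsub>R\<^esub> r)"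
    have inj: "inj_on ?f (carrier R)"
      using gen by (auto simp: generating_character_def bij_betw_def)
    have "emb i j x i j \<noteq> \<zero>\<^bsub>R\<^esub> i j" using x ij by (simp add: emb_def zero_R)
    then have "emb i j x \<noteq> \<zero>\<^bsub>R\<^esub>" by auto
    then have "?f (emb i j x) \<noteq> ?f \<zero>\<^bsub>R\<^esub>"
      using inj_onD[OF inj _ emb_mem[OF x(1)] zero_mem] by blast
    then obtain y where y: "?f (emb i j x) y \<noteq> ?f \<zero>\<^bsub>R\<^esub> y" unfolding fun_eq_iff by blast
    \<comment> \<open>Outside the carrier both restricted functions are \<open>undefined\<close>, so
      they could not differ there.\<close>
    then have yR: "y \<in> carrier R" by (auto simp: restrict_def split: if_splits)
    have "y \<otimes>\<^bsub>R\<^esub> \<zero>\<^bsub>R\<^esub> = \<zero>\<^bsub>R\<^esub>"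
      by (rule R_eqI[OF mult_mem[OF yR zero_mem] zero_mem])
        (auto simp: mult_R zero_R component_ring ring.ring_simprules R_mem[OF yR])
    moreover have "y \<otimes>\<^bsub>R\<^esub> emb i j x = emb i j (y i j \<otimes>\<^bsub>Rc i j\<^esub> x)"
    proof (rule R_eqI[OF mult_mem[OF yR emb_mem[OF x(1)]] emb_mem])
      show "y i j \<otimes>\<^bsub>Rc i j\<^esub> x \<in> carrier (Rc i j)" using R_mem[OF yR ij] x by simp
      show "(y \<otimes>\<^bsub>R\<^esub> emb i j x) k l = emb i j (y i j \<otimes>\<^bsub>Rc i j\<^esub> x) k l" if "k < t" "l < n k" for k l
        using that component_ring[OF that] R_mem[OF yR that]
        by (auto simp: mult_R emb_def ring.ring_simprules)
    qed
    ultimately have "\<chi> (emb i j (y i j \<otimes>\<^bsub>Rc i j\<^esub> x)) \<noteq> 1" using y yR chi_zero by simp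
    then show "\<exists>r\<in>carrier (Rc i j). \<chi> (emb i j (r \<otimes>\<^bsub>Rc i j\<^esub> x)) \<noteq> 1"
      using R_mem[OF yR ij] by blast
  qed
qed

section \<open>Character sums over the blocks of \<open>H_partition\<close>\<close>

lemma H_block_box: "H_block t n Rc m =
    {b \<in> box t n (\<lambda>i j. socle (Rc i j)). \<forall>i<t. card {j. j < n i \<and> b i j \<noteq> \<zero>\<^bsub>Rc i j\<^esub>} = m i}"
  by (simp add: H_block_def std_soc_box hwt_def)

lemma finite_socle: "i < t \<Longrightarrow> j < n i \<Longrightarrow> finite (socle (Rc i j))"
  using finite_local_ring_char.finite_L[OF component_char] .

lemma q_pos: "i < t \<Longrightarrow> 0 < n i \<Longrightarrow> 0 < q i"
  using finite_local_ring_q.one_less_q[OF component, of i 0] by simp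

text \<open>The variable \<open>F\<close> stands for left or for right multiplication by \<open>a\<close>, composed with \<open>\<chi>\<close>.\<close>
lemma sum_H_block:
  assumes g: "\<And>b. b \<in> carrier R \<Longrightarrow> g b = (\<Prod>i<t. \<Prod>j<n i. F i j (b i j))"
    and zero: "\<And>i j. i < t \<Longrightarrow> j < n i \<Longrightarrow> F i j \<zero>\<^bsub>Rc i j\<^esub> = 1"
    and nonzero: "\<And>i j. i < t \<Longrightarrow> j < n i \<Longrightarrow>
      (\<Sum>b\<in>{b \<in> socle (Rc i j). b \<noteq> \<zero>\<^bsub>Rc i j\<^esub>}. F i j b) =
        (if a i j \<in> jacobson_rad (Rc i j) then of_nat (q i) - 1 else - 1 :: complex)"
  shows "(\<Sum>b\<in>H_block t n Rc m. g b) = (\<Prod>i<t. coeff (krawtchouk (q i) (n i) (wtv_rad a i)) (m i))"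
proof -
  have "(\<Sum>b\<in>H_block t n Rc m. g b) = (\<Sum>b\<in>H_block t n Rc m. \<Prod>i<t. \<Prod>j<n i. F i j (b i j))"
    using g soc_subset by (intro sum.cong) (auto simp: H_block_def)
  also have "\<dots> = (\<Prod>i<t. coeff (\<Prod>j<n i. [:\<Sum>y\<in>{y \<in> socle (Rc i j). \<not> y \<noteq> \<zero>\<^bsub>Rc i j\<^esub>}. F i j y,
      \<Sum>y\<in>{y \<in> socle (Rc i j). y \<noteq> \<zero>\<^bsub>Rc i j\<^esub>}. F i j y:]) (m i))"
    unfolding H_block_box using finite_socle by (intro sum_box_weight) auto
  also have "\<dots> = (\<Prod>i<t. coeff (krawtchouk (q i) (n i) (wtv_rad a i)) (m i))"
  proof (intro prod.cong refl arg_cong2[where f = coeff])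
    fix i assume "i \<in> {..<t}"
    then have i: "i < t" by simp
    have "(\<Prod>j<n i. [:\<Sum>y\<in>{y \<in> socle (Rc i j). \<not> y \<noteq> \<zero>\<^bsub>Rc i j\<^esub>}. F i j y,
        \<Sum>y\<in>{y \<in> socle (Rc i j). y \<noteq> \<zero>\<^bsub>Rc i j\<^esub>}. F i j y:]) =
      smult (\<Prod>j<n i. 1) (krawtchouk (q i) (n i) (card {j. j < n i \<and> a i j \<notin> jacobson_rad (Rc i j)}))"
    proof (rule prod_krawtchouk)
      fix j assume j: "j < n i"
      have "{y \<in> socle (Rc i j). \<not> y \<noteq> \<zero>\<^bsub>Rc i j\<^esub>} = {\<zero>\<^bsub>Rc i j\<^esub>}"
        using finite_local_ring.zero_L[OF component_local[OF i j]] by auto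
      then show "(\<Sum>y\<in>{y \<in> socle (Rc i j). \<not> y \<noteq> \<zero>\<^bsub>Rc i j\<^esub>}. F i j y) = 1"
        using zero[OF i j] by simp
      show "(\<Sum>y\<in>{y \<in> socle (Rc i j). y \<noteq> \<zero>\<^bsub>Rc i j\<^esub>}. F i j y) =
          1 * (if a i j \<notin> jacobson_rad (Rc i j) then - 1 else of_nat (q i) - 1)"
        using nonzero[OF i j] by simp
    qed
    then show "(\<Prod>j<n i. [:\<Sum>y\<in>{y \<in> socle (Rc i j). \<not> y \<noteq> \<zero>\<^bsub>Rc i j\<^esub>}. F i j y,
        \<Sum>y\<in>{y \<in> socle (Rc i j). y \<noteq> \<zero>\<^bsub>Rc i j\<^esub>}. F i j y:]) = krawtchouk (q i) (n i) (wtv_rad a i)"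
      by (simp add: hwt_rad_def)
  qed
  finally show ?thesis .
qed

text \<open>The sum factors into component sums, each nonzero exactly when the coordinate of
  \<open>a\<close> is zero. Only this zero test is needed later, not the value.\<close>

lemma sum_carrier:
  assumes a: "a \<in> carrier R"
    and g: "\<And>b. b \<in> carrier R \<Longrightarrow> g b = (\<Prod>i<t. \<Prod>j<n i. F i j (b i j))"
    and F: "\<And>i j. i < t \<Longrightarrow> j < n i \<Longrightarrow> (\<Sum>b\<in>carrier (Rc i j). F i j b) =
        (if a i j = \<zero>\<^bsub>Rc i j\<^esub> then of_nat (card (carrier (Rc i j))) else 0 :: complex)"
  shows "(\<Sum>b\<in>carrier R. g b) = 0 \<longleftrightarrow> a \<noteq> \<zero>\<^bsub>R\<^esub>"
proof -
  have fin: "finite (carrier (Rc i j))" if "i < t" "j < n i" for i j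
    using finite_local_ring.finite_carrier[OF component_local[OF that]] .
  have "(\<Sum>b\<in>carrier R. g b) = (\<Sum>b\<in>carrier R. \<Prod>i<t. \<Prod>j<n i. F i j (b i j))"
    using g by (intro sum.cong) auto
  also have "\<dots> = (\<Prod>i<t. \<Prod>j<n i. \<Sum>b\<in>carrier (Rc i j). F i j b)"
    unfolding carrier_R using fin by (intro sum_box) auto
  finally have eq: "(\<Sum>b\<in>carrier R. g b) = (\<Prod>i<t. \<Prod>j<n i. if a i j = \<zero>\<^bsub>Rc i j\<^esub>
      then of_nat (card (carrier (Rc i j))) else 0)" using F by simp
  have nz: "card (carrier (Rc i j)) = 0 \<longleftrightarrow> False" if "i < t" "j < n i" for i j
    using fin[OF that] comp_zero[OF that] by (auto simp: card_eq_0_iff)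
  show ?thesis
    unfolding eq eq_zero_iff[OF a] by (auto simp: prod_zero_iff nz split: if_splits)
qed

lemma sum_soc:
  fixes h :: "(nat \<Rightarrow> nat \<Rightarrow> 'a) \<Rightarrow> complex"
  shows "(\<Sum>b\<in>std_soc t n Rc. h b) = (\<Sum>m\<in>idx_set t n. \<Sum>b\<in>H_block t n Rc m. h b)"
proof -
  have fin: "finite (std_soc t n Rc)" using finite_subset[OF soc_subset finite_R] .
  have "std_soc t n Rc = (\<Union>m\<in>idx_set t n. H_block t n Rc m)"
  proof (intro equalityI subsetI)
    fix a assume "a \<in> std_soc t n Rc"
    then have "a \<in> H_block t n Rc (restrict (wtv a) {..<t})" by (simp add: H_block_def)
    then show "a \<in> (\<Union>m\<in>idx_set t n. H_block t n Rc m)" using restrict_wtv_idx by blast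
  qed (auto simp: H_block_def)
  then have "(\<Sum>b\<in>std_soc t n Rc. h b) = (\<Sum>b\<in>(\<Union>m\<in>idx_set t n. H_block t n Rc m). h b)" by simp
  also have "\<dots> = (\<Sum>m\<in>idx_set t n. \<Sum>b\<in>H_block t n Rc m. h b)"
  proof (rule sum.UNION_disjoint)
    show "finite (idx_set t n)" by (auto simp: idx_set_def intro!: finite_PiE)
    show "\<forall>m\<in>idx_set t n. finite (H_block t n Rc m)"
      using fin by (auto simp: H_block_def)
    show "\<forall>m\<in>idx_set t n. \<forall>m'\<in>idx_set t n. m \<noteq> m' \<longrightarrow> H_block t n Rc m \<inter> H_block t n Rc m' = {}"
    proof (intro ballI impI, rule ccontr)
      fix m m' assume m: "m \<in> idx_set t n" "m' \<in> idx_set t n" "m \<noteq> m'"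
        and "H_block t n Rc m \<inter> H_block t n Rc m' \<noteq> {}"
      then obtain b where "b \<in> H_block t n Rc m" "b \<in> H_block t n Rc m'" by blast
      then have "m = m'" by (intro idx_ext[OF m(1,2)]) (auto simp: H_block_def)
      then show False using m by simp
    qed
  qed
  finally show ?thesis .
qed

text \<open>The sums over \<open>P\<^sub>m\<close> determine the weights modulo the radical; they also determine the sum over
  the socle, so that the block \<open>P\<^sub>\<diamond>\<close> contributes exactly the sum over \<open>R\<close>, which detects \<open>0\<close>.\<close>
lemma H_dual_rel_eq_Q_rel:
  fixes g :: "(nat \<Rightarrow> nat \<Rightarrow> 'a) \<Rightarrow> (nat \<Rightarrow> nat \<Rightarrow> 'a) \<Rightarrow> complex"
  assumes block: "\<And>a m. a \<in> carrier R \<Longrightarrow>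
      (\<Sum>b\<in>H_block t n Rc m. g a b) = (\<Prod>i<t. coeff (krawtchouk (q i) (n i) (wtv_rad a i)) (m i))"
    and all: "\<And>a. a \<in> carrier R \<Longrightarrow> (\<Sum>b\<in>carrier R. g a b) = 0 \<longleftrightarrow> a \<noteq> \<zero>\<^bsub>R\<^esub>"
  shows "{(a, a'). a \<in> carrier R \<and> a' \<in> carrier R \<and>
      (\<forall>P\<in>H_partition t n Rc. (\<Sum>b\<in>P. g a b) = (\<Sum>b\<in>P. g a' b))} = Q_rel"
proof -
  have diamond: "(\<Sum>b\<in>H_diamond t n Rc. g a b) = (\<Sum>b\<in>carrier R. g a b) - (\<Sum>b\<in>std_soc t n Rc. g a b)" for a
    unfolding H_diamond_def by (rule sum_diff[OF finite_R soc_subset])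
  have "(\<forall>P\<in>H_partition t n Rc. (\<Sum>b\<in>P. g a b) = (\<Sum>b\<in>P. g a' b)) \<longleftrightarrow>
      (\<forall>i<t. wtv_rad a i = wtv_rad a' i) \<and> (a = \<zero>\<^bsub>R\<^esub> \<longleftrightarrow> a' = \<zero>\<^bsub>R\<^esub>)" (is "?L \<longleftrightarrow> ?W \<and> ?Z")
    if a: "a \<in> carrier R" and a': "a' \<in> carrier R" for a a'
  proof -
    let ?E = "\<lambda>P. (\<Sum>b\<in>P. g a b) = (\<Sum>b\<in>P. g a' b)"
    have L: "?L \<longleftrightarrow> ?E (H_diamond t n Rc) \<and> (\<forall>m\<in>idx_set t n. ?E (H_block t n Rc m))"
      unfolding H_partition_def by (rule ball_nonempty_blocks) simp
    have W: "?W \<longleftrightarrow> (\<forall>m\<in>idx_set t n. ?E (H_block t n Rc m))"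
    proof
      assume E: "\<forall>m\<in>idx_set t n. ?E (H_block t n Rc m)"
      have "wtv_rad a i = wtv_rad a' i" if i: "i < t" for i
      proof (rule prod_coeff_krawtchouk_inj[where q = q, OF _ _ _ q_pos i])
        fix m assume "m \<in> idx_set t n"
        then have "?E (H_block t n Rc m)" using E by blast
        then show "(\<Prod>i<t. coeff (krawtchouk (q i) (n i) (wtv_rad a i)) (m i)) =
            (\<Prod>i<t. coeff (krawtchouk (q i) (n i) (wtv_rad a' i)) (m i))"
          unfolding block[OF a] block[OF a'] .
      qed (auto simp: hwt_rad_def card_bounded_le)
      then show ?W by blast
    qed (simp add: block[OF a] block[OF a'])
    have Z: "?E (H_diamond t n Rc) \<longleftrightarrow> ?E (carrier R)" if ?W
    proof -
      have "?E (std_soc t n Rc)" using that W by (simp add: sum_soc)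
      then show ?thesis unfolding diamond by simp
    qed
    have "?E (carrier R) \<longleftrightarrow> ?Z"
      using all[OF a] all[OF a'] by auto
    then show ?thesis using L W Z by blast
  qed
  then show ?thesis unfolding Q_rel_def by auto
qed

lemma chi_mult:
  assumes "a \<in> carrier R" "b \<in> carrier R"
  shows "\<chi> (a \<otimes>\<^bsub>R\<^esub> b) = (\<Prod>i<t. \<Prod>j<n i. \<chi> (emb i j (a i j \<otimes>\<^bsub>Rc i j\<^esub> b i j)))"
  using chi_prod[OF mult_mem[OF assms]] by (simp add: mult_R)

text \<open>Here \<open>a\<close> multiplies from the left, so the sum over \<open>R\<close> relies
  on the nondegeneracy obtained in \<open>f_right\<close>.\<close>

lemma right_dual_rel_H: "right_dual_rel R \<chi> (H_partition t n Rc) = Q_rel"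
  unfolding right_dual_rel_def
proof (rule H_dual_rel_eq_Q_rel)
  fix a assume a: "a \<in> carrier R"
  let ?F = "\<lambda>i j x. \<chi> (emb i j (a i j \<otimes>\<^bsub>Rc i j\<^esub> x))"
  show "(\<Sum>b\<in>H_block t n Rc m. \<chi> (a \<otimes>\<^bsub>R\<^esub> b)) =
      (\<Prod>i<t. coeff (krawtchouk (q i) (n i) (wtv_rad a i)) (m i))" for m
  proof (rule sum_H_block[where F = ?F])
    fix i j assume ij: "i < t" "j < n i"
    interpret A: finite_local_ring_char "Rc i j" "q i" "\<lambda>x. \<chi> (emb i j x)" by (rule component_char[OF ij])
    show "?F i j \<zero>\<^bsub>Rc i j\<^esub> = 1" using A.f_zero R_mem[OF a ij] by simp
    show "(\<Sum>b\<in>{b \<in> socle (Rc i j). b \<noteq> \<zero>\<^bsub>Rc i j\<^esub>}. ?F i j b) =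
        (if a i j \<in> jacobson_rad (Rc i j) then of_nat (q i) - 1 else - 1)"
      by (rule A.sum_socle_nonzero_lmult[OF R_mem[OF a ij]])
  qed (rule chi_mult[OF a])
  show "(\<Sum>b\<in>carrier R. \<chi> (a \<otimes>\<^bsub>R\<^esub> b)) = 0 \<longleftrightarrow> a \<noteq> \<zero>\<^bsub>R\<^esub>"
    by (rule sum_carrier[where F = ?F, OF a chi_mult[OF a]], assumption)
      (rule finite_local_ring_char.sum_carrier_lmult[OF component_char R_mem[OF a]])
qed

text \<open>Here \<open>a\<close> multiplies from the right: the sum over \<open>R\<close> uses the
  given nondegeneracy \<open>f_left\<close>, while the socle sums use that the radical kills the
  socle from the right.\<close>

lemma left_dual_rel_H: "left_dual_rel R \<chi> (H_partition t n Rc) = Q_rel"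
  unfolding left_dual_rel_def
proof (rule H_dual_rel_eq_Q_rel)
  fix a assume a: "a \<in> carrier R"
  let ?F = "\<lambda>i j x. \<chi> (emb i j (x \<otimes>\<^bsub>Rc i j\<^esub> a i j))"
  show "(\<Sum>b\<in>H_block t n Rc m. \<chi> (b \<otimes>\<^bsub>R\<^esub> a)) =
      (\<Prod>i<t. coeff (krawtchouk (q i) (n i) (wtv_rad a i)) (m i))" for m
  proof (rule sum_H_block[where F = ?F])
    fix i j assume ij: "i < t" "j < n i"
    interpret A: finite_local_ring_char "Rc i j" "q i" "\<lambda>x. \<chi> (emb i j x)" by (rule component_char[OF ij])
    show "?F i j \<zero>\<^bsub>Rc i j\<^esub> = 1" using A.f_zero R_mem[OF a ij] by simp
    show "(\<Sum>b\<in>{b \<in> socle (Rc i j). b \<noteq> \<zero>\<^bsub>Rc i j\<^esub>}. ?F i j b) =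
        (if a i j \<in> jacobson_rad (Rc i j) then of_nat (q i) - 1 else - 1)"
      by (rule A.sum_socle_nonzero_rmult[OF R_mem[OF a ij]])
  qed (rule chi_mult[OF _ a])
  show "(\<Sum>b\<in>carrier R. \<chi> (b \<otimes>\<^bsub>R\<^esub> a)) = 0 \<longleftrightarrow> a \<noteq> \<zero>\<^bsub>R\<^esub>"
    by (rule sum_carrier[where F = ?F, OF a chi_mult[OF _ a]], assumption)
      (rule finite_local_ring_char.sum_carrier_rmult[OF component_char R_mem[OF a]])
qed

text \<open>Only right multiplication by \<open>a\<close> occurs, since reflexivity asks for the
  left dual of the right dual. A coordinate of \<open>a\<close> contributes |J| (1 + (q - 1) X) if
  it is zero, |J| (1 - X) if it is a nonzero socle element, and 0 otherwise.\<close>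

lemma sum_rad_weight:
  assumes a: "a \<in> carrier R"
  shows "(\<Sum>b\<in>{b \<in> carrier R. \<forall>i<t. wtv_rad b i = m i}. \<chi> (b \<otimes>\<^bsub>R\<^esub> a)) =
    (if a \<in> std_soc t n Rc
     then (\<Prod>i<t. \<Prod>j<n i. of_nat (card (jacobson_rad (Rc i j)))) *
       (\<Prod>i<t. coeff (krawtchouk (q i) (n i) (wtv a i)) (m i))
     else 0)"
proof -
  let ?F = "\<lambda>i j x. \<chi> (emb i j (x \<otimes>\<^bsub>Rc i j\<^esub> a i j))"
  let ?u = "\<lambda>i j. \<Sum>y\<in>{y \<in> carrier (Rc i j). \<not> y \<notin> jacobson_rad (Rc i j)}. ?F i j y"
  let ?v = "\<lambda>i j. \<Sum>y\<in>{y \<in> carrier (Rc i j). y \<notin> jacobson_rad (Rc i j)}. ?F i j y"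
  have u: "?u i j = (if a i j \<in> socle (Rc i j) then of_nat (card (jacobson_rad (Rc i j))) else 0)"
    if ij: "i < t" "j < n i" for i j
  proof -
    interpret A: finite_local_ring_char "Rc i j" "q i" "\<lambda>x. \<chi> (emb i j x)" by (rule component_char[OF ij])
    have "{y \<in> carrier (Rc i j). \<not> y \<notin> A.J} = A.J" using A.J_carrier by auto
    then show ?thesis using A.sum_rad_rmult[OF R_mem[OF a ij]] by simp
  qed
  have v: "?v i j = (if a i j \<in> socle (Rc i j) then of_nat (card (jacobson_rad (Rc i j))) *
      (if a i j = \<zero>\<^bsub>Rc i j\<^esub> then of_nat (q i) - 1 else - 1) else 0)"
    if ij: "i < t" "j < n i" for i j
    by (rule finite_local_ring_char.sum_nonrad_rmult[OF component_char[OF ij] R_mem[OF a ij]])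
  have "(\<Sum>b\<in>{b \<in> carrier R. \<forall>i<t. wtv_rad b i = m i}. \<chi> (b \<otimes>\<^bsub>R\<^esub> a)) =
      (\<Sum>b\<in>{b \<in> carrier R. \<forall>i<t. wtv_rad b i = m i}. \<Prod>i<t. \<Prod>j<n i. ?F i j (b i j))"
    using chi_mult[OF _ a] by (intro sum.cong) auto
  also have "\<dots> = (\<Prod>i<t. coeff (\<Prod>j<n i. [:?u i j, ?v i j:]) (m i))"
    unfolding carrier_R hwt_rad_def
    using finite_local_ring.finite_carrier[OF component_local] by (intro sum_box_weight) auto
  also have "\<dots> = (if a \<in> std_soc t n Rc
     then (\<Prod>i<t. \<Prod>j<n i. of_nat (card (jacobson_rad (Rc i j)))) *
       (\<Prod>i<t. coeff (krawtchouk (q i) (n i) (wtv a i)) (m i))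
     else 0)"
  proof (cases "a \<in> std_soc t n Rc")
    case True
    then have s: "a i j \<in> socle (Rc i j)" if "i < t" "j < n i" for i j
      using in_soc_iff[OF a] that by blast
    have "(\<Prod>j<n i. [:?u i j, ?v i j:]) = smult (\<Prod>j<n i. of_nat (card (jacobson_rad (Rc i j))))
        (krawtchouk (q i) (n i) (wtv a i))" if i: "i < t" for i
      unfolding hwt_def using u[OF i] v[OF i] s[OF i] by (intro prod_krawtchouk) auto
    then have "(\<Prod>i<t. coeff (\<Prod>j<n i. [:?u i j, ?v i j:]) (m i)) =
        (\<Prod>i<t. (\<Prod>j<n i. of_nat (card (jacobson_rad (Rc i j)))) *
          coeff (krawtchouk (q i) (n i) (wtv a i)) (m i))"
      by (intro prod.cong) auto
    then show ?thesis using True by (simp add: prod.distrib)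
  next
    case False
    \<comment> \<open>A single coordinate outside the socle makes its whole linear factor vanish,
      and with it the entire product for every \<open>m\<close>.\<close>
    then obtain i j where ij: "i < t" "j < n i" "a i j \<notin> socle (Rc i j)"
      using in_soc_iff[OF a] by blast
    then have "[:?u i j, ?v i j:] = 0" using u v by simp
    then have "(\<Prod>j<n i. [:?u i j, ?v i j:]) = 0" using ij(2) by (intro prod_zero) auto
    then have "coeff (\<Prod>j<n i. [:?u i j, ?v i j:]) (m i) = 0" by (simp only: coeff_0)
    then have "\<exists>i\<in>{..<t}. coeff (\<Prod>j<n i. [:?u i j, ?v i j:]) (m i) = 0"
      using ij(1) unfolding Bex_def lessThan_iff by blast
    then have "(\<Prod>i<t. coeff (\<Prod>j<n i. [:?u i j, ?v i j:]) (m i)) = 0"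
      by (rule prod_zero[OF finite_lessThan])
    then show ?thesis using False by simp
  qed
  finally show ?thesis .
qed

text \<open>Since \<open>\<chi> 0 = 1\<close>, splitting the radical into \<open>Q\<^sub>0\<close> and \<open>Q\<^sub>\<diamond>\<close> gives no information beyond the sum
  over the whole radical, which tells the socle from its complement.\<close>
lemma left_dual_rel_Q: "left_dual_rel R \<chi> (Q_partition t n Rc) = H_rel"
proof -
  let ?V = "\<lambda>m. {b \<in> carrier R. \<forall>i<t. wtv_rad b i = m i}"
  let ?S = "\<lambda>a X. \<Sum>b\<in>X. \<chi> (b \<otimes>\<^bsub>R\<^esub> a)"
  define c :: complex where "c = (\<Prod>i<t. \<Prod>j<n i. of_nat (card (jacobson_rad (Rc i j))))"
  note weight = sum_rad_weight[folded c_def]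
  have c: "c \<noteq> 0"
  proof -
    have "card (jacobson_rad (Rc i j)) = 0 \<longleftrightarrow> False" if ij: "i < t" "j < n i" for i j
      using finite_local_ring_char.finite_J[OF component_char[OF ij]]
        finite_local_ring.zero_J[OF component_local[OF ij]] by (auto simp: card_eq_0_iff)
    then show ?thesis by (simp add: c_def prod_zero_iff)
  qed
  have V0: "?V (idx_zero t) = std_rad t n Rc"
    using in_rad_iff_wtv rad_subset by (auto simp: idx_zero_def)
  have Q0: "Q_block t n Rc (idx_zero t) = {\<zero>\<^bsub>R\<^esub>}" by (simp add: Q_block_def)
  have "?S a (std_rad t n Rc) = ?S a {\<zero>\<^bsub>R\<^esub>} + ?S a (Q_diamond t n Rc)" for a
    unfolding Q_diamond_def using zero_in_rad finite_subset[OF rad_subset finite_R]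
    by (subst sum.remove[of _ "\<zero>\<^bsub>R\<^esub>"]) auto
  moreover have zero: "?S a {\<zero>\<^bsub>R\<^esub>} = 1" if a: "a \<in> carrier R" for a
  proof -
    have "\<zero>\<^bsub>R\<^esub> \<otimes>\<^bsub>R\<^esub> a = \<zero>\<^bsub>R\<^esub>"
      by (rule R_eqI[OF mult_mem[OF zero_mem a] zero_mem])
        (auto simp: mult_R zero_R component_ring ring.ring_simprules R_mem[OF a])
    then show ?thesis using chi_zero by simp
  qed
  ultimately have rad: "?S a (?V (idx_zero t)) = 1 + ?S a (Q_diamond t n Rc)" if "a \<in> carrier R" for a
    using that unfolding V0 by simp
  have "(\<forall>P\<in>Q_partition t n Rc. ?S a P = ?S a' P) \<longleftrightarrow>
      (a \<in> std_soc t n Rc \<longleftrightarrow> a' \<in> std_soc t n Rc) \<and>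
      (a \<in> std_soc t n Rc \<longrightarrow> (\<forall>i<t. wtv a i = wtv a' i))" (is "?L \<longleftrightarrow> ?H")
    if a: "a \<in> carrier R" and a': "a' \<in> carrier R" for a a'
  proof -
    let ?E = "\<lambda>P. ?S a P = ?S a' P"
    have "?L \<longleftrightarrow> ?E (Q_diamond t n Rc) \<and> (\<forall>m\<in>idx_set t n. ?E (Q_block t n Rc m))"
      unfolding Q_partition_def by (rule ball_nonempty_blocks) simp
    also have "\<dots> \<longleftrightarrow> (\<forall>m\<in>idx_set t n. ?E (?V m))"
    proof -
      have d: "?E (Q_diamond t n Rc) \<longleftrightarrow> ?E (?V (idx_zero t))"
        unfolding rad[OF a] rad[OF a'] by simp
      have z: "?E (Q_block t n Rc (idx_zero t))"
        unfolding Q0 zero[OF a] zero[OF a'] by (rule refl)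
      have nz: "?E (Q_block t n Rc m) \<longleftrightarrow> ?E (?V m)" if "m \<in> idx_set t n" "m \<noteq> idx_zero t" for m
        unfolding Q_block_nonzero[OF that] by (rule refl)
      show ?thesis
      proof (intro iffI ballI conjI)
        fix m assume m: "m \<in> idx_set t n"
          and L: "?E (Q_diamond t n Rc) \<and> (\<forall>m\<in>idx_set t n. ?E (Q_block t n Rc m))"
        show "?E (?V m)"
        proof (cases "m = idx_zero t")
          case True
          show ?thesis unfolding True using L d by blast
        qed (use L nz[OF m] m in blast)
      next
        fix m assume m: "m \<in> idx_set t n" and V: "\<forall>m\<in>idx_set t n. ?E (?V m)"
        show "?E (Q_block t n Rc m)"
        proof (cases "m = idx_zero t")
          case True
          show ?thesis unfolding True by (rule z)
        qed (use V nz[OF m] m in blast)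
      qed (use d idx_zero_mem in blast)
    qed
    also have "\<dots> \<longleftrightarrow> ?H"
    proof
      assume E: "\<forall>m\<in>idx_set t n. ?E (?V m)"
      \<comment> \<open>At index 0 the Krawtchouk product is 1, so the sum over the radical is
        \<open>c\<close> or 0 according to membership in the socle. Since \<open>c\<close> is
        nonzero, membership is detected before any weights are compared.\<close>
      have z: "(\<Prod>i<t. coeff (krawtchouk (q i) (n i) (w i)) (idx_zero t i)) = 1" for w
        by (simp add: idx_zero_def coeff_0_krawtchouk)
      have "?E (?V (idx_zero t))" using E idx_zero_mem by blast
      then have iff: "a \<in> std_soc t n Rc \<longleftrightarrow> a' \<in> std_soc t n Rc"
        unfolding weight[OF a] weight[OF a'] z using c by (simp split: if_splits)
      have "wtv a i = wtv a' i" if i: "i < t" and s: "a \<in> std_soc t n Rc" for i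
      proof (rule prod_coeff_krawtchouk_inj[where q = q, OF _ _ _ q_pos i])
        fix m assume "m \<in> idx_set t n"
        then have "?E (?V m)" using E by blast
        then show "(\<Prod>i<t. coeff (krawtchouk (q i) (n i) (wtv a i)) (m i)) =
            (\<Prod>i<t. coeff (krawtchouk (q i) (n i) (wtv a' i)) (m i))"
          unfolding weight[OF a] weight[OF a'] using c s iff by simp
      qed (auto simp: hwt_def card_bounded_le)
      then show ?H using iff by blast
    next
      assume H: ?H
      show "\<forall>m\<in>idx_set t n. ?E (?V m)"
        unfolding weight[OF a] weight[OF a'] using H by simp
    qed
    finally show ?thesis .
  qed
  then show ?thesis unfolding left_dual_rel_def H_rel_def by auto
qed

lemma right_dual_H: "right_dual R \<chi> (H_partition t n Rc) = Q_partition t n Rc"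
  by (simp add: right_dual_def right_dual_rel_H Q_quotient)

lemma left_dual_H: "left_dual R \<chi> (H_partition t n Rc) = Q_partition t n Rc"
  by (simp add: left_dual_def left_dual_rel_H Q_quotient)

lemma reflexive_H: "reflexive_partition R \<chi> (H_partition t n Rc)"
  by (simp add: reflexive_partition_def right_dual_H left_dual_def left_dual_rel_Q H_quotient)

end

theorem theorem4p1:
  fixes t :: nat and n :: "nat \<Rightarrow> nat" and q :: "nat \<Rightarrow> nat"
    and Rc :: "nat \<Rightarrow> nat \<Rightarrow> 'a ring"
    and \<chi> :: "(nat \<Rightarrow> nat \<Rightarrow> 'a) \<Rightarrow> complex"
  assumes comp: "\<And>i j. i < t \<Longrightarrow> j < n i \<Longrightarrow> finite_local_frobenius (Rc i j)"
    and res_card: "\<And>i j. i < t \<Longrightarrow> j < n i \<Longrightarrow>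
                     card (carrier (Rc i j Quot jacobson_rad (Rc i j))) = q i"
    and soc_card: "\<And>i j. i < t \<Longrightarrow> j < n i \<Longrightarrow> card (socle (Rc i j)) = q i"
    and q_dist: "inj_on q {..<t}"
    and gen: "generating_character (std_ring t n Rc) \<chi>"
  shows "(\<forall>\<chi>'. generating_character (std_ring t n Rc) \<chi>' \<longrightarrow>
            right_dual (std_ring t n Rc) \<chi>' (H_partition t n Rc)
              = right_dual (std_ring t n Rc) \<chi> (H_partition t n Rc))
       \<and> left_dual (std_ring t n Rc) \<chi> (H_partition t n Rc)
           = right_dual (std_ring t n Rc) \<chi> (H_partition t n Rc)
       \<and> right_dual (std_ring t n Rc) \<chi> (H_partition t n Rc) = Q_partition t n Rc
       \<and> reflexive_partition (std_ring t n Rc) \<chi> (H_partition t n Rc)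
       \<and> (carrier (std_ring t n Rc) = std_soc t n Rc \<longrightarrow>
            card (H_partition t n Rc) = (\<Prod>i<t. n i + 1)
            \<and> H_partition t n Rc = product_partition t (\<lambda>i. hamming_partition (n i) (Rc i))
            \<and> self_dual_partition (std_ring t n Rc) \<chi> (H_partition t n Rc))
       \<and> (carrier (std_ring t n Rc) \<noteq> std_soc t n Rc \<longrightarrow>
            card (H_partition t n Rc) = (\<Prod>i<t. n i + 1) + 1)"
proof -
  interpret standard_form t n q Rc
    by unfold_locales (fact comp res_card soc_card)+
  \<comment> \<open>The computed dual \<open>Q_partition\<close> does not mention the character, so
    instantiating the computation at an arbitrary \<open>\<chi>'\<close> yields the independence
    claim.\<close>
  have char: "standard_form_char t n q Rc \<chi>'"
    if "generating_character (std_ring t n Rc) \<chi>'" for \<chi>'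
    by unfold_locales (fact that)
  interpret standard_form_char t n q Rc \<chi> by (rule char[OF gen])
  show ?thesis
  proof (intro conjI allI impI)
    fix \<chi>' assume "generating_character R \<chi>'"
    then show "right_dual R \<chi>' (H_partition t n Rc) = right_dual R \<chi> (H_partition t n Rc)"
      using standard_form_char.right_dual_H[OF char] right_dual_H by simp
  next
    show "left_dual R \<chi> (H_partition t n Rc) = right_dual R \<chi> (H_partition t n Rc)"
      by (simp add: right_dual_H left_dual_H)
  next
    assume soc: "carrier R = std_soc t n Rc"
    show "card (H_partition t n Rc) = (\<Prod>i<t. n i + 1)"
      unfolding H_partition_if_soc[OF soc] by (rule card_H_blocks)
    show "H_partition t n Rc = product_partition t (\<lambda>i. hamming_partition (n i) (Rc i))"
      by (rule H_partition_product[OF soc])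
    show "self_dual_partition R \<chi> (H_partition t n Rc)"
      unfolding self_dual_partition_def right_dual_H by (rule Q_partition_if_soc[OF soc])
  qed (fact right_dual_H reflexive_H card_H_partition_if_not_soc)+
qed

end
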